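(* A continuous function $v:\mathbb R^d\to\mathbb R_+$ is a solution of Problem 1, i.e. $$v(x)=\sup_{(\tau,\alpha)\in\mathcal D}\mathsf E_x\left[e^{-r\tau}\varphi(X_\tau)\mathbf 1_{\{\alpha=0\}}+e^{-r(\tau+\vartheta)}\left(p\psi(X_{\tau+\vartheta})+(1-p)v(X_{\tau+\vartheta})\right)\mathbf 1_{\{\alpha=1\}}\right]\quad\text{for all }x\in\mathbb R^d,$$ if and only if it solves Problem 2, i.e. $$v(x)=\sup_{\tau\in\mathcal T}\mathsf E_x\left[e^{-r\tau}\max\{\varphi(X_\tau),(\Lambda v)(X_\tau)\}\right]\quad\text{for all }x\in\mathbb R^d.$$ Moreover, if Problem 2 has a solution $v$ and admits an optimal stopping time $\tau_*$, then the couple $(\tau_*,\alpha^* )$, with $\alpha^*:=\mathbf 1_{\{(\Lambda v)(X_{\tau_*})>\varphi(X_{\tau_*})\}}$, is optimal for Problem 1.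
   Context: $(\Omega,\mathcal F,\mathsf P)$ is a probability space endowed with a right-continuous and complete filtration $\mathbb F=(\mathcal F_t)_{t\ge0}$, with $\mathcal F_\infty=\bigvee_{t\ge0}\mathcal F_t=:\mathcal F$. $X=(X_t)_{t\ge0}$ is a right-continuous strong Markov process with values in $\mathbb R^d$, which can be realised as a stochastic flow $(t,x)\mapsto X^x_t$ with $X^x_0=x$, $\mathsf P$-a.s.; $X$ is also quasi left-continuous, i.e. left-continuous over stopping times. Notation: $\mathsf P_x(\cdot)=\mathsf P(\cdot|X_0=x)$ and, for any integrable functional $f$ on the space of right-continuous paths in $\mathbb R^d$, $\mathsf E_x[f(X_\cdot)]=\mathsf E[f(X^x_\cdot)]=\mathsf E[f(X_\cdot)|X_0=x]$; by the strong Markov property, $\mathsf E_{X_\tau}[f(X_\cdot)]=\mathsf E[f(X_{\tau+\cdot})|\mathcal F_\tau]$ for any $\mathbb F$-stopping time $\tau$. $\vartheta$ is a non-negative random variable, independent of $X$, with cumulative distribution $F$. $r>0$ and $p\in(0,1)$ are constants, and $\varphi,\psi:\mathbb R^d\to\mathbb R_+$ are continuous with $\varphi\le\psi$ on $\mathbb R^d$, where $\mathbb R_+=[0,\infty)$. The time horizon is infinite: $\mathcal T$ is the set of $\mathbb F$-stopping times (unbounded, possibly infinite), and $$\mathcal D=\{(\tau,\alpha):\ \tau\in\mathcal T,\ \alpha\in\{0,1\},\ \alpha\text{ is }\mathcal F_\tau\text{-measurable}\}.$$ Convention: $f(X^x_\tau)\mathbf 1_{\{\tau=\infty\}}=\limsup_{t\to\infty}f(X^x_t)$,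 $\mathsf P$-a.s., for any Borel-measurable $f:\mathbb R^d\to\mathbb R$, each $x\in\mathbb R^d$ and any $\tau\in\mathcal T$. For any continuous function $f:\mathbb R^d\to\mathbb R_+$, $$(\Lambda f)(x):=\int_0^\infty e^{-rt}\,\mathsf E_x\left[p\psi(X_t)+(1-p)f(X_t)\right]F(\mathrm dt).$$
   Formalization: ϑ is assumed independent of the whole σ-algebra F_∞ (not only of X) and may live on a larger probability space than (Ω, F_∞); with independence of X alone, α could depend on ϑ and the claim fails. *)

theory Defs
  imports "HOL-Probability.Probability"
begin

(* The filtration is indexed by [0,\<infinity>] (type ennreal) with Fil \<infinity> the sigma-algebra generated by
   all Fil t, t < \<infinity>.  Thus the library's stopping_time and pre_sigma give exactly the possibly
   infinite stopping times tau and the sigma-algebras F_tau (sub-sigma-algebras of F_infinity).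

   The base probability space carrying X is (space M, Fil \<infinity>, M restricted to Fil \<infinity>); the
   measure space M may be larger, so that it can also carry the random time theta, which is
   independent of F_infinity. Accordingly, completeness is relative to the
   null sets of that base space. *)

definition usual_conditions :: "'w measure \<Rightarrow> (ennreal \<Rightarrow> 'w measure) \<Rightarrow> bool" where
  "usual_conditions M Fil \<longleftrightarrow>
     filtration (space M) Fil \<and>
     (\<forall>t. subalgebra M (Fil t)) \<and>
     sets (Fil \<infinity>) = sigma_sets (space M) (\<Union>t\<in>{..<\<infinity>}. sets (Fil t)) \<and>
     (\<forall>t<\<infinity>. sets (Fil t) = (\<Inter>s\<in>{t<..<\<infinity>}. sets (Fil s))) \<and>
     (\<forall>N\<in>sets (Fil \<infinity>). emeasure M N = 0 \<longrightarrow> (\<forall>A\<subseteq>N. A \<in> sets (Fil 0)))"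

(* Paths are indexed by {0..}; path_space carries the sigma-algebra generated by the coordinates. *)

definition path_space :: "(real \<Rightarrow> 'x::topological_space) measure" where
  "path_space = restrict_space (PiM {0..} (\<lambda>_. borel)) {w. \<forall>t\<ge>0. continuous (at_right t) w}"

definition path_from :: "(real \<Rightarrow> 'w \<Rightarrow> 'x) \<Rightarrow> real \<Rightarrow> 'w \<Rightarrow> (real \<Rightarrow> 'x)" where
  "path_from Y t \<omega> = (\<lambda>s\<in>{0..}. Y (t + s) \<omega>)"

(* E_x[f(X)] = E[f(X^x)], where X x t \<omega> is the flow X^x_t(\<omega>) *)

definition Ex :: "'w measure \<Rightarrow> ('x \<Rightarrow> real \<Rightarrow> 'w \<Rightarrow> 'x) \<Rightarrow> 'x \<Rightarrow> ((real \<Rightarrow> 'x) \<Rightarrow> ennreal) \<Rightarrow> ennreal" where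
  "Ex M X x f = (\<integral>\<^sup>+ \<omega>. f (path_from (X x) 0 \<omega>) \<partial>M)"

(* The identity E_{X_tau}[f(X)] = E[f(X_{tau+.}) | F_tau] on {tau < \<infinity>}, for nonnegative measurable
   path functionals f (the case of integrable f follows by splitting f into positive and negative parts).
   The first conjunct makes E_{X_tau}[f(X)] a random variable. *)

definition strong_markov ::
  "'w measure \<Rightarrow> (ennreal \<Rightarrow> 'w measure) \<Rightarrow> ('x::topological_space \<Rightarrow> real \<Rightarrow> 'w \<Rightarrow> 'x) \<Rightarrow> bool" where
  "strong_markov M Fil X \<longleftrightarrow>
     (\<forall>f\<in>borel_measurable path_space.
        (\<lambda>y. Ex M X y f) \<in> borel_measurable borel \<and>
        (\<forall>x \<tau>. stopping_time Fil \<tau> \<longrightarrow>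
          (AE \<omega> in M.
             nn_cond_exp M (filtration.pre_sigma (space M) Fil \<tau>)
               (\<lambda>\<omega>. f (path_from (X x) (enn2real (\<tau> \<omega>)) \<omega>) * indicator {\<omega>. \<tau> \<omega> < \<infinity>} \<omega>) \<omega>
             = Ex M X (X x (enn2real (\<tau> \<omega>)) \<omega>) f * indicator {\<omega>. \<tau> \<omega> < \<infinity>} \<omega>)))"

definition quasi_left_continuous ::
  "'w measure \<Rightarrow> (ennreal \<Rightarrow> 'w measure) \<Rightarrow> ('x::topological_space \<Rightarrow> real \<Rightarrow> 'w \<Rightarrow> 'x) \<Rightarrow> bool" where
  "quasi_left_continuous M Fil X \<longleftrightarrow>
     (\<forall>x \<sigma> \<tau>. (\<forall>n::nat. stopping_time Fil (\<sigma> n)) \<longrightarrow>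
        (\<forall>\<omega>\<in>space M. incseq (\<lambda>n. \<sigma> n \<omega>) \<and> \<tau> \<omega> = (SUP n. \<sigma> n \<omega>)) \<longrightarrow>
        (AE \<omega> in M. \<tau> \<omega> < \<infinity> \<longrightarrow>
           (\<lambda>n. X x (enn2real (\<sigma> n \<omega>)) \<omega>) \<longlonglongrightarrow> X x (enn2real (\<tau> \<omega>)) \<omega>))"

definition strong_markov_flow ::
  "'w measure \<Rightarrow> (ennreal \<Rightarrow> 'w measure) \<Rightarrow> ('x::topological_space \<Rightarrow> real \<Rightarrow> 'w \<Rightarrow> 'x) \<Rightarrow> bool" where
  "strong_markov_flow M Fil X \<longleftrightarrow>
     (\<forall>x. \<forall>t\<ge>0. X x t \<in> borel_measurable (Fil (ennreal t))) \<and>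
     (\<forall>x. \<forall>\<omega>\<in>space M. \<forall>t\<ge>0. continuous (at_right t) (\<lambda>s. X x s \<omega>)) \<and>
     (\<forall>x. AE \<omega> in M. X x 0 \<omega> = x) \<and>
     strong_markov M Fil X \<and>
     quasi_left_continuous M Fil X"

definition independent_time ::
  "'w measure \<Rightarrow> (ennreal \<Rightarrow> 'w measure) \<Rightarrow> ('w \<Rightarrow> real) \<Rightarrow> bool" where
  "independent_time M Fil \<theta> \<longleftrightarrow>
     \<theta> \<in> borel_measurable M \<and> (\<forall>\<omega>\<in>space M. 0 \<le> \<theta> \<omega>) \<and>
     prob_space.indep_set M (sets (Fil \<infinity>)) (sets (vimage_algebra (space M) \<theta> borel))"

(* f(Y_tau), with the convention f(Y_tau) = limsup_{t \<rightarrow> \<infinity>} f(Y_t) on {tau = \<infinity>} *)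

definition eval_at :: "(real \<Rightarrow> 'w \<Rightarrow> 'x) \<Rightarrow> ('x \<Rightarrow> ennreal) \<Rightarrow> ('w \<Rightarrow> ennreal) \<Rightarrow> 'w \<Rightarrow> ennreal" where
  "eval_at Y f \<tau> \<omega> =
     (if \<tau> \<omega> = \<infinity> then Limsup at_top (\<lambda>t. f (Y t \<omega>)) else f (Y (enn2real (\<tau> \<omega>)) \<omega>))"

(* e^{-rt} for t in [0,\<infinity>], with e^{-r\<infinity>} = 0.  Products e^{-r tau} f(X_tau) use 0 * \<infinity> = 0. *)

definition discount :: "real \<Rightarrow> ennreal \<Rightarrow> ennreal" where
  "discount r t = (if t = \<infinity> then 0 else ennreal (exp (- r * enn2real t)))"

(* F is a distribution function; F(dt) integrates over [0,\<infinity>), including an atom at 0.  The values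
   of \<Lambda> f are a priori in [0,\<infinity>]. *)

definition Lam ::
  "'w measure \<Rightarrow> ('x \<Rightarrow> real \<Rightarrow> 'w \<Rightarrow> 'x) \<Rightarrow> (real \<Rightarrow> real) \<Rightarrow> real \<Rightarrow> real \<Rightarrow> ('x \<Rightarrow> real)
     \<Rightarrow> ('x \<Rightarrow> real) \<Rightarrow> 'x \<Rightarrow> ennreal" where
  "Lam M X F r p \<psi> f x =
     (\<integral>\<^sup>+ t\<in>{0..}. ennreal (exp (- r * t)) *
        (\<integral>\<^sup>+ \<omega>. ennreal (p * \<psi> (X x t \<omega>) + (1 - p) * f (X x t \<omega>)) \<partial>M) \<partial>interval_measure F)"

definition admissible :: "'w measure \<Rightarrow> (ennreal \<Rightarrow> 'w measure) \<Rightarrow> (('w \<Rightarrow> ennreal) \<times> ('w \<Rightarrow> nat)) set" where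
  "admissible M Fil =
     {(\<tau>, \<alpha>). stopping_time Fil \<tau> \<and>
        \<alpha> \<in> filtration.pre_sigma (space M) Fil \<tau> \<rightarrow>\<^sub>M count_space {0, 1}}"

definition payoff1 ::
  "'w measure \<Rightarrow> ('x \<Rightarrow> real \<Rightarrow> 'w \<Rightarrow> 'x) \<Rightarrow> ('w \<Rightarrow> real) \<Rightarrow> real \<Rightarrow> real \<Rightarrow> ('x \<Rightarrow> real) \<Rightarrow> ('x \<Rightarrow> real)
     \<Rightarrow> ('x \<Rightarrow> real) \<Rightarrow> 'x \<Rightarrow> ('w \<Rightarrow> ennreal) \<times> ('w \<Rightarrow> nat) \<Rightarrow> ennreal" where
  "payoff1 M X \<theta> r p \<phi> \<psi> v x = (\<lambda>(\<tau>, \<alpha>).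
     let \<rho> = (\<lambda>\<omega>. \<tau> \<omega> + ennreal (\<theta> \<omega>)) in
     (\<integral>\<^sup>+ \<omega>. discount r (\<tau> \<omega>) * eval_at (X x) (\<lambda>y. ennreal (\<phi> y)) \<tau> \<omega> * indicator {\<omega>. \<alpha> \<omega> = 0} \<omega>
        + discount r (\<rho> \<omega>) *
            (ennreal p * eval_at (X x) (\<lambda>y. ennreal (\<psi> y)) \<rho> \<omega>
             + ennreal (1 - p) * eval_at (X x) (\<lambda>y. ennreal (v y)) \<rho> \<omega>) * indicator {\<omega>. \<alpha> \<omega> = 1} \<omega> \<partial>M))"

definition payoff2 ::
  "'w measure \<Rightarrow> ('x \<Rightarrow> real \<Rightarrow> 'w \<Rightarrow> 'x) \<Rightarrow> (real \<Rightarrow> real) \<Rightarrow> real \<Rightarrow> real \<Rightarrow> ('x \<Rightarrow> real) \<Rightarrow> ('x \<Rightarrow> real)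
     \<Rightarrow> ('x \<Rightarrow> real) \<Rightarrow> 'x \<Rightarrow> ('w \<Rightarrow> ennreal) \<Rightarrow> ennreal" where
  "payoff2 M X F r p \<phi> \<psi> v x \<tau> =
     (\<integral>\<^sup>+ \<omega>. discount r (\<tau> \<omega>) *
        max (eval_at (X x) (\<lambda>y. ennreal (\<phi> y)) \<tau> \<omega>) (eval_at (X x) (Lam M X F r p \<psi> v) \<tau> \<omega>) \<partial>M)"

definition solves_problem1 ::
  "'w measure \<Rightarrow> (ennreal \<Rightarrow> 'w measure) \<Rightarrow> ('x \<Rightarrow> real \<Rightarrow> 'w \<Rightarrow> 'x) \<Rightarrow> ('w \<Rightarrow> real) \<Rightarrow> real \<Rightarrow> real
     \<Rightarrow> ('x \<Rightarrow> real) \<Rightarrow> ('x \<Rightarrow> real) \<Rightarrow> ('x \<Rightarrow> real) \<Rightarrow> bool" where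
  "solves_problem1 M Fil X \<theta> r p \<phi> \<psi> v \<longleftrightarrow>
     (\<forall>x. ennreal (v x) = (SUP \<tau>\<alpha>\<in>admissible M Fil. payoff1 M X \<theta> r p \<phi> \<psi> v x \<tau>\<alpha>))"

definition solves_problem2 ::
  "'w measure \<Rightarrow> (ennreal \<Rightarrow> 'w measure) \<Rightarrow> ('x \<Rightarrow> real \<Rightarrow> 'w \<Rightarrow> 'x) \<Rightarrow> (real \<Rightarrow> real) \<Rightarrow> real \<Rightarrow> real
     \<Rightarrow> ('x \<Rightarrow> real) \<Rightarrow> ('x \<Rightarrow> real) \<Rightarrow> ('x \<Rightarrow> real) \<Rightarrow> bool" where
  "solves_problem2 M Fil X F r p \<phi> \<psi> v \<longleftrightarrow>
     (\<forall>x. ennreal (v x) = (SUP \<tau>\<in>{\<tau>. stopping_time Fil \<tau>}. payoff2 M X F r p \<phi> \<psi> v x \<tau>))"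

(* Optimality for the problem started at x, i.e. under P_x.  The optimiser may depend on x. *)

definition optimal_problem1 ::
  "'w measure \<Rightarrow> (ennreal \<Rightarrow> 'w measure) \<Rightarrow> ('x \<Rightarrow> real \<Rightarrow> 'w \<Rightarrow> 'x) \<Rightarrow> ('w \<Rightarrow> real) \<Rightarrow> real \<Rightarrow> real
     \<Rightarrow> ('x \<Rightarrow> real) \<Rightarrow> ('x \<Rightarrow> real) \<Rightarrow> ('x \<Rightarrow> real) \<Rightarrow> 'x \<Rightarrow> ('w \<Rightarrow> ennreal) \<times> ('w \<Rightarrow> nat) \<Rightarrow> bool" where
  "optimal_problem1 M Fil X \<theta> r p \<phi> \<psi> v x \<tau>\<alpha> \<longleftrightarrow>
     \<tau>\<alpha> \<in> admissible M Fil \<and>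
     payoff1 M X \<theta> r p \<phi> \<psi> v x \<tau>\<alpha> = (SUP \<sigma>\<beta>\<in>admissible M Fil. payoff1 M X \<theta> r p \<phi> \<psi> v x \<sigma>\<beta>)"

definition optimal_problem2 ::
  "'w measure \<Rightarrow> (ennreal \<Rightarrow> 'w measure) \<Rightarrow> ('x \<Rightarrow> real \<Rightarrow> 'w \<Rightarrow> 'x) \<Rightarrow> (real \<Rightarrow> real) \<Rightarrow> real \<Rightarrow> real
     \<Rightarrow> ('x \<Rightarrow> real) \<Rightarrow> ('x \<Rightarrow> real) \<Rightarrow> ('x \<Rightarrow> real) \<Rightarrow> 'x \<Rightarrow> ('w \<Rightarrow> ennreal) \<Rightarrow> bool" where
  "optimal_problem2 M Fil X F r p \<phi> \<psi> v x \<tau> \<longleftrightarrow>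
     stopping_time Fil \<tau> \<and>
     payoff2 M X F r p \<phi> \<psi> v x \<tau> = (SUP \<sigma>\<in>{\<sigma>. stopping_time Fil \<sigma>}. payoff2 M X F r p \<phi> \<psi> v x \<sigma>)"

definition alpha_star ::
  "'w measure \<Rightarrow> ('x \<Rightarrow> real \<Rightarrow> 'w \<Rightarrow> 'x) \<Rightarrow> (real \<Rightarrow> real) \<Rightarrow> real \<Rightarrow> real \<Rightarrow> ('x \<Rightarrow> real) \<Rightarrow> ('x \<Rightarrow> real)
     \<Rightarrow> ('x \<Rightarrow> real) \<Rightarrow> 'x \<Rightarrow> ('w \<Rightarrow> ennreal) \<Rightarrow> 'w \<Rightarrow> nat" where
  "alpha_star M X F r p \<phi> \<psi> v x \<tau> \<omega> =
     (if eval_at (X x) (Lam M X F r p \<psi> v) \<tau> \<omega> > eval_at (X x) (\<lambda>y. ennreal (\<phi> y)) \<tau> \<omega> then 1 else 0)"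

end

(* Independence integrates the random delay out and the strong Markov property restarts the flow at tau, so
   that paying at tau + theta is worth (Lam v)(X_tau) at time tau:
     payoff1 (tau, alpha) = E[e^(-r tau) (phi(X_tau) 1{alpha = 0} + (Lam v)(X_tau) 1{alpha = 1})].
   The integrand is at most the one of payoff2 tau, with equality for the choice alpha_star, hence both
   problems have the same value for every v.  The delicate point is that alpha_star is F_tau-measurable on
   {tau = infinity}, where it compares upper limits in continuous time of merely Borel functions of the
   flow; this rests on the measurable projection theorem for the complete sigma-algebra F_infinity, which is
   proved by Choquet's capacitability argument for Souslin schemes. *)

theory Submission
  imports Defs
begin

text \<open>The time \<open>\<tau> + \<theta>\<close> need not be a stopping time of
  \<open>Fil\<close>, so the strong Markov property cannot be invoked there. Averaging over
  \<open>\<theta>\<close> for a frozen path first leaves a functional of the path after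
  \<open>\<tau>\<close> alone, and this can be conditioned at \<open>\<tau>\<close>. All payoffs are
  integrals in \<open>ennreal\<close>, so Tonelli applies throughout and no finiteness has to be
  established beforehand. The event that \<open>\<tau>\<close> is infinite has discount zero and
  adds nothing to any payoff, yet an admissible action must be measurable there too. Since
  \<open>Lam\<close> is only known to be Borel, a supremum over \<open>t \<ge> n\<close> along the
  flow cannot be reduced to rational times; its level sets are projections of jointly measurable
  sets. Such sets are rewritten through rectangles with closed sides in the time direction, so that
  compactness can produce the time whose existence the projection asserts.\<close>

section \<open>Measurable projections\<close>

text \<open>The second clause lets level \<open>n\<close> depend on the first \<open>n\<close>
  entries of a branch only. Full sequences thus stand in for the finite sequences that usually index
  the Souslin operation.\<close>

definition souslin_scheme ::
  "'a measure \<Rightarrow> (nat \<Rightarrow> (nat \<Rightarrow> nat) \<Rightarrow> 'a set) \<Rightarrow> (nat \<Rightarrow> (nat \<Rightarrow> nat) \<Rightarrow> 't::topological_space set) \<Rightarrow> bool"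
  where
  "souslin_scheme N B K \<longleftrightarrow>
     (\<forall>n \<sigma>. B n \<sigma> \<in> sets N \<and> closed (K n \<sigma>)) \<and>
     (\<forall>n \<sigma> \<tau>. (\<forall>i<n. \<sigma> i = \<tau> i) \<longrightarrow> B n \<sigma> = B n \<tau> \<and> K n \<sigma> = K n \<tau>)"

definition souslin_kernel ::
  "(nat \<Rightarrow> (nat \<Rightarrow> nat) \<Rightarrow> 'a set) \<Rightarrow> (nat \<Rightarrow> (nat \<Rightarrow> nat) \<Rightarrow> 't set) \<Rightarrow> ('a \<times> 't) set" where
  "souslin_kernel B K = {(w, t). \<exists>\<sigma>. \<forall>n. w \<in> B n \<sigma> \<and> t \<in> K n \<sigma>}"

definition souslin_set :: "'a measure \<Rightarrow> ('a \<times> 't::topological_space) set \<Rightarrow> bool" where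
  "souslin_set N A \<longleftrightarrow> (\<exists>B K. souslin_scheme N B K \<and> A = souslin_kernel B K)"

lemma souslin_schemeD:
  assumes "souslin_scheme N B K"
  shows "B n \<sigma> \<in> sets N" "closed (K n \<sigma>)"
    and "(\<And>i. i < n \<Longrightarrow> \<sigma> i = \<tau> i) \<Longrightarrow> B n \<sigma> = B n \<tau>"
    and "(\<And>i. i < n \<Longrightarrow> \<sigma> i = \<tau> i) \<Longrightarrow> K n \<sigma> = K n \<tau>"
  using assms unfolding souslin_scheme_def by blast+

section \<open>Closure properties of Souslin sets\<close>

lemma souslin_set_Times:
  assumes "b \<in> sets N" "closed k"
  shows "souslin_set N (b \<times> k)"
proof -
  have "souslin_scheme N (\<lambda>_ _. b) (\<lambda>_ _. k)"
    using assms by (simp add: souslin_scheme_def)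
  moreover have "b \<times> k = souslin_kernel (\<lambda>_ _. b) (\<lambda>_ _. k)"
    by (auto simp: souslin_kernel_def)
  ultimately show ?thesis
    unfolding souslin_set_def by (intro exI conjI)
qed

lemma souslin_set_UN:
  fixes A :: "nat \<Rightarrow> ('a \<times> 't::topological_space) set"
  assumes "\<And>i. souslin_set N (A i)"
  shows "souslin_set N (\<Union>i. A i)"
proof -
  obtain B K where BK: "\<And>i. souslin_scheme N (B i) (K i)"
    and A: "\<And>i. A i = souslin_kernel (B i) (K i)"
    using assms unfolding souslin_set_def by metis
  \<comment> \<open>Entry 0 of the branch selects the set, the shifted branch runs in its scheme.
    Level 0 may not look at any entry, hence the trivial value there.\<close>
  define B' where "B' n \<sigma> = (case n of 0 \<Rightarrow> space N | Suc m \<Rightarrow> B (\<sigma> 0) m (\<lambda>j. \<sigma> (Suc j)))" for n and \<sigma> :: "nat \<Rightarrow> nat"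
  define K' where "K' n \<sigma> = (case n of 0 \<Rightarrow> UNIV | Suc m \<Rightarrow> K (\<sigma> 0) m (\<lambda>j. \<sigma> (Suc j)))" for n and \<sigma> :: "nat \<Rightarrow> nat"
  have B_space: "w \<in> space N" if "w \<in> B i n \<sigma>" for i n \<sigma> w
    using souslin_schemeD(1)[OF BK] that by (meson sets.sets_into_space subsetD)
  have "souslin_scheme N B' K'"
    unfolding souslin_scheme_def
  proof (intro conjI allI impI)
    fix n and \<sigma> \<tau> :: "nat \<Rightarrow> nat"
    show "B' n \<sigma> \<in> sets N" "closed (K' n \<sigma>)"
      by (auto simp: B'_def K'_def souslin_schemeD(1,2)[OF BK] split: nat.split)
    assume eq: "\<forall>i<n. \<sigma> i = \<tau> i"
    show "B' n \<sigma> = B' n \<tau>"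
    proof (cases n)
      case (Suc m)
      have "B (\<tau> 0) m (\<lambda>j. \<sigma> (Suc j)) = B (\<tau> 0) m (\<lambda>j. \<tau> (Suc j))"
        by (rule souslin_schemeD(3)[OF BK]) (use eq Suc in auto)
      then show ?thesis using eq Suc by (simp add: B'_def)
    qed (simp add: B'_def)
    show "K' n \<sigma> = K' n \<tau>"
    proof (cases n)
      case (Suc m)
      have "K (\<tau> 0) m (\<lambda>j. \<sigma> (Suc j)) = K (\<tau> 0) m (\<lambda>j. \<tau> (Suc j))"
        by (rule souslin_schemeD(4)[OF BK]) (use eq Suc in auto)
      then show ?thesis using eq Suc by (simp add: K'_def)
    qed (simp add: K'_def)
  qed
  moreover have "(\<Union>i. A i) = souslin_kernel B' K'"
  proof (intro equalityI subsetI)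
    fix x assume "x \<in> (\<Union>i. A i)"
    then obtain i w t \<sigma> where x: "x = (w, t)" "\<And>n. w \<in> B i n \<sigma> \<and> t \<in> K i n \<sigma>"
      by (auto simp: A souslin_kernel_def)
    have "w \<in> space N" using x(2)[of 0] B_space by blast
    then have "w \<in> B' n (case_nat i \<sigma>) \<and> t \<in> K' n (case_nat i \<sigma>)" for n
      using x(2) by (auto simp: B'_def K'_def split: nat.split)
    then show "x \<in> souslin_kernel B' K'"
      unfolding x(1) souslin_kernel_def by blast
  next
    fix x assume "x \<in> souslin_kernel B' K'"
    then obtain w t \<sigma> where x: "x = (w, t)" "\<And>n. w \<in> B' n \<sigma> \<and> t \<in> K' n \<sigma>"
      by (auto simp: souslin_kernel_def)
    have "w \<in> B (\<sigma> 0) m (\<lambda>j. \<sigma> (Suc j)) \<and> t \<in> K (\<sigma> 0) m (\<lambda>j. \<sigma> (Suc j))" for m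
      using x(2)[of "Suc m"] by (simp add: B'_def K'_def)
    then show "x \<in> (\<Union>i. A i)"
      using x(1) by (auto simp: A souslin_kernel_def)
  qed
  ultimately show ?thesis
    unfolding souslin_set_def by (intro exI conjI)
qed

text \<open>Ensures that the first \<open>n\<close> entries of the \<open>i\<close>-th interleaved
  branch sit below position \<open>prod_encode (i, n)\<close>, so the interleaved scheme still
  depends on finite prefixes.\<close>

lemma prod_encode_less: "j < n \<Longrightarrow> prod_encode (i, j) < prod_encode (i, n)"
  by (induction n) (auto simp: prod_encode_def less_Suc_eq)

text \<open>The branches of countably many schemes are interleaved into one branch by the pairing function.\<close>

lemma souslin_set_INT:
  fixes A :: "nat \<Rightarrow> ('a \<times> 't::topological_space) set"
  assumes "\<And>i. souslin_set N (A i)"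
  shows "souslin_set N (\<Inter>i. A i)"
proof -
  obtain B K where BK: "\<And>i. souslin_scheme N (B i) (K i)"
    and A: "\<And>i. A i = souslin_kernel (B i) (K i)"
    using assms unfolding souslin_set_def by metis
  define sub where "sub i \<sigma> = (\<lambda>j. \<sigma> (prod_encode (i, j)))" for i and \<sigma> :: "nat \<Rightarrow> nat"
  define B' where "B' m \<sigma> = (case prod_decode m of (i, n) \<Rightarrow> B i n (sub i \<sigma>))" for m and \<sigma> :: "nat \<Rightarrow> nat"
  define K' where "K' m \<sigma> = (case prod_decode m of (i, n) \<Rightarrow> K i n (sub i \<sigma>))" for m and \<sigma> :: "nat \<Rightarrow> nat"
  have "souslin_scheme N B' K'"
    unfolding souslin_scheme_def
  proof (intro conjI allI impI)
    fix m and \<sigma> \<tau> :: "nat \<Rightarrow> nat"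
    show "B' m \<sigma> \<in> sets N" "closed (K' m \<sigma>)"
      by (auto simp: B'_def K'_def souslin_schemeD(1,2)[OF BK] split: prod.split)
    assume eq: "\<forall>i<m. \<sigma> i = \<tau> i"
    obtain i n where m: "m = prod_encode (i, n)"
      by (metis prod_decode_inverse surj_pair)
    have "sub i \<sigma> j = sub i \<tau> j" if "j < n" for j
      using eq prod_encode_less[OF that] by (auto simp: sub_def m)
    then show "B' m \<sigma> = B' m \<tau>" "K' m \<sigma> = K' m \<tau>"
      by (auto simp: B'_def K'_def m intro!: souslin_schemeD(3,4)[OF BK])
  qed
  moreover have "(\<Inter>i. A i) = souslin_kernel B' K'"
  proof (intro equalityI subsetI)
    fix x assume x: "x \<in> (\<Inter>i. A i)"
    obtain w t where wt: "x = (w, t)" by force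
    have "\<forall>i. \<exists>\<sigma>. \<forall>n. w \<in> B i n \<sigma> \<and> t \<in> K i n \<sigma>"
      using x by (auto simp: A wt souslin_kernel_def)
    then obtain \<sigma> where \<sigma>: "\<And>i n. w \<in> B i n (\<sigma> i) \<and> t \<in> K i n (\<sigma> i)"
      by metis
    have "sub i (\<lambda>m. case prod_decode m of (i, j) \<Rightarrow> \<sigma> i j) = \<sigma> i" for i
      by (simp add: sub_def)
    then have "w \<in> B' n (\<lambda>m. case prod_decode m of (i, j) \<Rightarrow> \<sigma> i j) \<and>
               t \<in> K' n (\<lambda>m. case prod_decode m of (i, j) \<Rightarrow> \<sigma> i j)" for n
      using \<sigma> by (simp add: B'_def K'_def split: prod.split)
    then show "x \<in> souslin_kernel B' K'"
      unfolding wt souslin_kernel_def by blast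
  next
    fix x assume "x \<in> souslin_kernel B' K'"
    then obtain w t \<sigma> where x: "x = (w, t)" "\<And>n. w \<in> B' n \<sigma> \<and> t \<in> K' n \<sigma>"
      by (auto simp: souslin_kernel_def)
    have "w \<in> B i n (sub i \<sigma>) \<and> t \<in> K i n (sub i \<sigma>)" for i n
      using x(2)[of "prod_encode (i, n)"] by (simp add: B'_def K'_def)
    then show "x \<in> (\<Inter>i. A i)"
      using x(1) by (auto simp: A souslin_kernel_def)
  qed
  ultimately show ?thesis
    unfolding souslin_set_def by (intro exI conjI)
qed

lemma souslin_set_Un:
  assumes "souslin_set N A" "souslin_set N B"
  shows "souslin_set N (A \<union> B)"
proof -
  have "A \<union> B = (\<Union>i. case_nat A (\<lambda>_. B) i)"
    by (auto split: nat.splits intro: exI[of _ 0] exI[of _ "Suc 0"])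
  then show ?thesis
    using assms by (auto intro!: souslin_set_UN split: nat.split)
qed

lemma sets_pair_borel_imp_souslin_set:
  fixes A :: "('a \<times> 't::euclidean_space) set"
  assumes "A \<in> sets (N \<Otimes>\<^sub>M borel)"
  shows "souslin_set N A"
proof -
  let ?Z = "space N \<times> (UNIV :: 't set)"
  let ?E = "{a \<times> k | a k. a \<in> sets N \<and> k \<in> {k :: 't set. closed k}}"
  have "sets (N \<Otimes>\<^sub>M (borel :: 't measure)) = sets (sigma (space N \<times> space (borel :: 't measure)) ?E)"
  proof (rule sets_pair_eq)
    show "sets N \<subseteq> Pow (space N)" by (rule sets.space_closed)
    show "sets N = sigma_sets (space N) (sets N)" by (simp add: sets.sigma_sets_eq)
    show "sets (borel :: 't measure) = sigma_sets (space borel) {k. closed k}"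
      by (simp add: borel_eq_closed)
    show "{space N} \<subseteq> sets N" "{UNIV :: 't set} \<subseteq> {k. closed k}" by auto
  qed auto
  also have "\<dots> = sigma_sets ?Z ?E"
    using sets.sets_into_space by (subst sets_measure_of) auto
  finally have "A \<in> sigma_sets ?Z ?E"
    using assms by simp
  \<comment> \<open>Souslin sets are not closed under complement in general, so the induction
    carries the set and its complement together; countable unions and intersections then exchange
    roles.\<close>
  then have "souslin_set N A \<and> souslin_set N (?Z - A)"
  proof induction
    case (Basic A)
    then obtain a k where A: "A = a \<times> k" and a: "a \<in> sets N" and k: "closed k"
      by auto
    \<comment> \<open>The complement of a closed side is open, hence a countable union of compact
      and therefore closed sets.\<close>
    obtain C where C: "\<And>n::nat. compact (C n)" "(\<Union>n. C n) = - k"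
      using open_Union_compact_subsets[of "- k"] k by (metis open_Compl)
    have "?Z - A = ((space N - a) \<times> UNIV) \<union> (\<Union>n. space N \<times> C n)"
      using C(2) sets.sets_into_space[OF a] by (auto simp: A souslin_kernel_def)
    then show ?case
      using a k C(1) by (auto simp: A compact_imp_closed intro!: souslin_set_Un souslin_set_UN souslin_set_Times)
  next
    case Empty
    show ?case
      using souslin_set_Times[of "{}" N UNIV] souslin_set_Times[of "space N" N UNIV] by simp
  next
    case (Compl A)
    have "?Z - (?Z - A) = A"
      using Compl(1) sigma_sets_into_sp[of ?E ?Z A] sets.sets_into_space by blast
    then show ?case using Compl by simp
  next
    case (Union A)
    have "?Z - (\<Union>i. A i) = (\<Inter>i. ?Z - A i)" by auto
    moreover have "souslin_set N (\<Union>i. A i)" "souslin_set N (\<Inter>i. ?Z - A i)"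
      using Union by (blast intro: souslin_set_UN souslin_set_INT)+
    ultimately show ?case by argo
  qed
  then show ?thesis ..
qed

section \<open>Capacitability and the projection theorem\<close>

lemma compact_nat_box: "compact {\<sigma> :: nat \<Rightarrow> nat. \<forall>i. \<sigma> i \<le> b i}"
proof -
  have "compactin (product_topology (\<lambda>_. euclidean) UNIV) (PiE UNIV (\<lambda>i. {..b i}))"
    unfolding compactin_PiE by (auto simp: finite_imp_compact)
  then show ?thesis
    by (simp add: euclidean_product_topology PiE_UNIV_domain Pi_def Collect_conj_eq)
qed

text \<open>The inner approximation in Choquet's capacitability argument: the branches of the scheme are
  bounded coordinatewise at an arbitrarily small loss of outer measure, and the bounded branches form
  a compact set.\<close>

lemma souslin_projection_inner:
  fixes T :: "'t::t2_space set"
  assumes N: "finite_measure N" and scheme: "souslin_scheme N B K" and T: "compact T"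
    and c: "c < outer_measure_of N {w. \<exists>t\<in>T. \<exists>\<sigma>. \<forall>n. w \<in> B n \<sigma> \<and> t \<in> K n \<sigma>}"
  shows "\<exists>E\<in>sets N. E \<subseteq> {w. \<exists>t\<in>T. \<exists>\<sigma>. \<forall>n. w \<in> B n \<sigma> \<and> t \<in> K n \<sigma>} \<and> c \<le> emeasure N E"
proof -
  interpret finite_measure N by fact
  note [simp] = souslin_schemeD(1)[OF scheme]
  \<comment> \<open>The part of the projection reached by branches whose first \<open>k\<close>
    entries are bounded by \<open>b\<close>; no bound is imposed on later entries yet.\<close>
  define S where "S k b = {w. \<exists>t\<in>T. \<exists>\<sigma>. (\<forall>i<k. \<sigma> i \<le> b i) \<and> (\<forall>n. w \<in> B n \<sigma> \<and> t \<in> K n \<sigma>)}"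
    for k :: nat and b :: "nat \<Rightarrow> nat"
  have S_space: "S k b \<subseteq> space N" for k b
    using sets.sets_into_space[OF souslin_schemeD(1)[OF scheme]] by (fastforce simp: S_def)
  have S_cong: "S k b = S k b'" if "\<And>i. i < k \<Longrightarrow> b i = b' i" for k b b'
    using that by (simp add: S_def)
  have S_Suc: "S k b = (\<Union>m. S (Suc k) (b(k := m)))" for k b
  proof (intro equalityI subsetI)
    fix w assume "w \<in> S k b"
    then obtain t \<sigma> where "t \<in> T" "\<forall>i<k. \<sigma> i \<le> b i" "\<forall>n. w \<in> B n \<sigma> \<and> t \<in> K n \<sigma>"
      by (auto simp: S_def)
    then have "w \<in> S (Suc k) (b(k := \<sigma> k))"
      unfolding S_def by (auto simp: less_Suc_eq intro!: bexI[of _ t] exI[of _ \<sigma>])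
    then show "w \<in> (\<Union>m. S (Suc k) (b(k := m)))" by blast
  next
    fix w assume "w \<in> (\<Union>m. S (Suc k) (b(k := m)))"
    then obtain m t \<sigma> where "t \<in> T" "\<forall>i<Suc k. \<sigma> i \<le> (b(k := m)) i" "\<forall>n. w \<in> B n \<sigma> \<and> t \<in> K n \<sigma>"
      by (auto simp: S_def)
    moreover from this have "\<sigma> i \<le> b i" if "i < k" for i
      using that by (metis fun_upd_other less_Suc_eq nat_neq_iff)
    ultimately show "w \<in> S k b" unfolding S_def by blast
  qed
  have S_mono: "incseq (\<lambda>m. S (Suc k) (b(k := m)))" for k b
  proof (intro monoI subsetI)
    fix m m' :: nat and w assume "m \<le> m'" "w \<in> S (Suc k) (b(k := m))"
    then obtain t \<sigma> where *: "t \<in> T" "\<forall>i<Suc k. \<sigma> i \<le> (b(k := m)) i" "\<forall>n. w \<in> B n \<sigma> \<and> t \<in> K n \<sigma>"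
      by (auto simp: S_def)
    have "\<sigma> i \<le> (b(k := m')) i" if "i < Suc k" for i
      using *(2) that \<open>m \<le> m'\<close> by (cases "i = k") force+
    then show "w \<in> S (Suc k) (b(k := m'))"
      using * unfolding S_def by blast
  qed
  \<comment> \<open>Outer measure is continuous along increasing sequences of arbitrary subsets of
    the space. A large enough bound on entry \<open>k\<close> therefore keeps it above
    \<open>c\<close>, while the earlier bounds stay as they are.\<close>
  have "\<exists>b. \<forall>k. c < outer_measure_of N (S k (b k)) \<and> (\<forall>i<k. b (Suc k) i = b k i)"
  proof (rule dependent_nat_choice)
    show "\<exists>b. c < outer_measure_of N (S 0 b)"
      using c by (simp add: S_def)
  next
    fix b k assume "c < outer_measure_of N (S k b)"
    also have "\<dots> = (SUP m. outer_measure_of N (S (Suc k) (b(k := m))))"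
      by (subst S_Suc) (intro SUP_outer_measure_of_incseq[symmetric] S_mono S_space)
    finally obtain m where "c < outer_measure_of N (S (Suc k) (b(k := m)))"
      by (auto simp: less_SUP_iff)
    then show "\<exists>b'. c < outer_measure_of N (S (Suc k) b') \<and> (\<forall>i<k. b' i = b i)"
      by (intro exI[of _ "b(k := m)"]) auto
  qed
  then obtain bs where bs: "\<And>k. c < outer_measure_of N (S k (bs k))"
    and bs_Suc: "\<And>k i. i < k \<Longrightarrow> bs (Suc k) i = bs k i"
    by blast
  define b where "b i = bs (Suc i) i" for i
  have bs_eq: "bs k i = b i" if "i < k" for i k
    using that by (induction k) (auto simp: b_def less_Suc_eq bs_Suc)
  have cS: "c < outer_measure_of N (S k b)" for k
    using bs[of k] S_cong[of k "bs k" b] bs_eq by simp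
  \<comment> \<open>Bounded branches that vanish from position \<open>k\<close> on. The sum is only
    a crude common bound on the entries, which makes finiteness immediate.\<close>
  define \<Sigma> where "\<Sigma> k = {\<sigma>. \<forall>i. (i \<in> {..<k} \<longrightarrow> \<sigma> i \<in> {..\<Sum>j<k. b j}) \<and> (i \<notin> {..<k} \<longrightarrow> \<sigma> i = 0)} \<inter> {\<sigma>. \<forall>i. \<sigma> i \<le> b i}"
    for k :: nat
  have fin: "finite (\<Sigma> k)" for k
    unfolding \<Sigma>_def by (intro finite_Int disjI1 finite_set_of_finite_funs) auto
  \<comment> \<open>A measurable outer approximation of \<open>S k b\<close>: only levels up to
    \<open>k\<close> are tested, and these see only a truncated branch, so finitely many branches
    suffice. Truncating with zeros also makes the bound hold at every entry.\<close>
  define D where "D k = {w. \<exists>t\<in>T. \<exists>\<sigma>. (\<forall>i. \<sigma> i \<le> b i) \<and> (\<forall>n\<le>k. w \<in> B n \<sigma> \<and> t \<in> K n \<sigma>)}" for k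
  have trunc: "(\<lambda>i. if i < k then \<sigma> i else 0) \<in> \<Sigma> k" if "\<forall>i<k. \<sigma> i \<le> b i" for \<sigma> k
  proof -
    have "\<sigma> i \<le> (\<Sum>j<k. b j)" if "i < k" for i
      using \<open>\<forall>i<k. \<sigma> i \<le> b i\<close> member_le_sum[of i "{..<k}" b] that by fastforce
    then show ?thesis using that by (auto simp: \<Sigma>_def)
  qed
  have truncBK: "B n (\<lambda>i. if i < k then \<sigma> i else 0) = B n \<sigma>" "K n (\<lambda>i. if i < k then \<sigma> i else 0) = K n \<sigma>"
    if "n \<le> k" for n k \<sigma>
    using that by (auto intro!: souslin_schemeD(3,4)[OF scheme])
  have D_eq: "D k = (\<Union>\<sigma>\<in>{\<sigma>\<in>\<Sigma> k. T \<inter> (\<Inter>n\<le>k. K n \<sigma>) \<noteq> {}}. \<Inter>n\<le>k. B n \<sigma>)" for k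
  proof (intro equalityI subsetI)
    fix w assume "w \<in> D k"
    then obtain t \<sigma> where *: "t \<in> T" "\<forall>i. \<sigma> i \<le> b i" "\<forall>n\<le>k. w \<in> B n \<sigma> \<and> t \<in> K n \<sigma>"
      by (auto simp: D_def)
    let ?\<sigma> = "\<lambda>i. if i < k then \<sigma> i else 0"
    have "?\<sigma> \<in> \<Sigma> k" by (rule trunc) (use * in auto)
    moreover have "t \<in> T \<inter> (\<Inter>n\<le>k. K n ?\<sigma>)" "w \<in> (\<Inter>n\<le>k. B n ?\<sigma>)"
      using * by (auto simp: truncBK)
    ultimately show "w \<in> (\<Union>\<sigma>\<in>{\<sigma>\<in>\<Sigma> k. T \<inter> (\<Inter>n\<le>k. K n \<sigma>) \<noteq> {}}. \<Inter>n\<le>k. B n \<sigma>)"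
      by blast
  next
    fix w assume "w \<in> (\<Union>\<sigma>\<in>{\<sigma>\<in>\<Sigma> k. T \<inter> (\<Inter>n\<le>k. K n \<sigma>) \<noteq> {}}. \<Inter>n\<le>k. B n \<sigma>)"
    then obtain \<sigma> t where "\<sigma> \<in> \<Sigma> k" "t \<in> T" "\<forall>n\<le>k. w \<in> B n \<sigma> \<and> t \<in> K n \<sigma>"
      by auto
    moreover from this(1) have "\<forall>i. \<sigma> i \<le> b i" unfolding \<Sigma>_def by blast
    ultimately show "w \<in> D k" unfolding D_def by blast
  qed
  have D_sets: "D k \<in> sets N" for k
    unfolding D_eq using fin[of k] by (intro sets.finite_UN sets.finite_INT) auto
  have "S k b \<subseteq> D k" for k
  proof
    fix w assume "w \<in> S k b"
    then obtain t \<sigma> where *: "t \<in> T" "\<forall>i<k. \<sigma> i \<le> b i" "\<forall>n. w \<in> B n \<sigma> \<and> t \<in> K n \<sigma>"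
      by (auto simp: S_def)
    then show "w \<in> D k"
      unfolding D_def
      by (auto simp: truncBK intro!: bexI[of _ t] exI[of _ "\<lambda>i. if i < k then \<sigma> i else 0"])
  qed
  then have cD: "c \<le> emeasure N (D k)" for k
    using cS[of k] outer_measure_of_mono[of "S k b" "D k" N] D_sets[of k] by auto
  have "decseq D"
  proof (intro antimonoI subsetI)
    fix m k :: nat and w assume "m \<le> k" "w \<in> D k"
    from this(2) obtain t \<sigma> where *: "t \<in> T" "\<forall>i. \<sigma> i \<le> b i" "\<forall>n\<le>k. w \<in> B n \<sigma> \<and> t \<in> K n \<sigma>"
      by (auto simp: D_def)
    then have "\<forall>n\<le>m. w \<in> B n \<sigma> \<and> t \<in> K n \<sigma>"
      using \<open>m \<le> k\<close> by (meson order_trans)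
    then show "w \<in> D m"
      using * unfolding D_def by (intro CollectI bexI[of _ t] exI[of _ \<sigma>]) auto
  qed
  then have "c \<le> emeasure N (\<Inter>k. D k)"
    using D_sets cD by (subst INF_emeasure_decseq'[symmetric]) (auto intro: INF_greatest)
  moreover have "(\<Inter>k. D k) \<in> sets N"
    using D_sets by auto
  moreover have "(\<Inter>k. D k) \<subseteq> {w. \<exists>t\<in>T. \<exists>\<sigma>. \<forall>n. w \<in> B n \<sigma> \<and> t \<in> K n \<sigma>}"
  proof
    fix w assume w: "w \<in> (\<Inter>k. D k)"
    define R where "R n = {(t, \<sigma>). w \<in> B n \<sigma> \<and> t \<in> K n \<sigma>}" for n
    \<comment> \<open>Membership in each \<open>D k\<close> gives a time and a branch that vary with
      \<open>k\<close>. The finite intersection property of the closed sets \<open>R n\<close> in a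
      compact product yields one pair serving all levels.\<close>
    have "(T \<times> {\<sigma>. \<forall>i. \<sigma> i \<le> b i}) \<inter> (\<Inter>n\<in>UNIV. R n) \<noteq> {}"
    proof (rule compact_imp_fip_image)
      show "compact (T \<times> {\<sigma>. \<forall>i. \<sigma> i \<le> b i})"
        using T compact_nat_box by (rule compact_Times)
    next
      fix n
      \<comment> \<open>Level \<open>n\<close> is constant on the cylinder of branches sharing a
        prefix of length \<open>n\<close>, and such cylinders are open.\<close>
      have "- R n = (\<Union>\<tau>. (if w \<in> B n \<tau> then - K n \<tau> else UNIV) \<times> {\<sigma>. \<forall>i\<in>{..<n}. \<sigma> i \<in> {\<tau> i}})"
      proof (intro equalityI subsetI)
        fix x assume "x \<in> (\<Union>\<tau>. (if w \<in> B n \<tau> then - K n \<tau> else UNIV) \<times> {\<sigma>. \<forall>i\<in>{..<n}. \<sigma> i \<in> {\<tau> i}})"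
        then obtain t \<sigma> \<tau> where x: "x = (t, \<sigma>)" "t \<in> (if w \<in> B n \<tau> then - K n \<tau> else UNIV)" "\<And>i. i < n \<Longrightarrow> \<sigma> i = \<tau> i"
          by auto
        then show "x \<in> - R n"
          using souslin_schemeD(3,4)[OF scheme, of n \<sigma> \<tau>] by (auto simp: R_def split: if_splits)
      qed (auto simp: R_def)
      also have "open \<dots>"
      proof (intro open_UN ballI open_Times)
        fix \<tau> :: "nat \<Rightarrow> nat"
        show "open (if w \<in> B n \<tau> then - K n \<tau> else UNIV)"
          using souslin_schemeD(2)[OF scheme] by auto
        have "open (PiE UNIV (\<lambda>i. if i < n then {\<tau> i} else UNIV))"
          by (rule open_PiE) (auto intro: Topological_Spaces.open_discrete finite_subset[of _ "{..<n}"])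
        also have "PiE UNIV (\<lambda>i. if i < n then {\<tau> i} else UNIV) = {\<sigma>. \<forall>i\<in>{..<n}. \<sigma> i \<in> {\<tau> i}}"
          by (auto simp: PiE_UNIV_domain Pi_def)
        finally show "open {\<sigma>. \<forall>i\<in>{..<n}. \<sigma> i \<in> {\<tau> i}}" .
      qed
      finally show "closed (R n)" by (simp add: closed_def)
    next
      fix I :: "nat set" assume "finite I"
      then obtain k where k: "\<And>n. n \<in> I \<Longrightarrow> n \<le> k"
        by (metis finite_nat_set_iff_bounded_le)
      have "w \<in> D k" using w by blast
      then obtain t \<sigma> where *: "t \<in> T" "\<forall>i. \<sigma> i \<le> b i" "\<forall>n\<le>k. w \<in> B n \<sigma> \<and> t \<in> K n \<sigma>"
        by (auto simp: D_def)
      then have "(t, \<sigma>) \<in> (T \<times> {\<sigma>. \<forall>i. \<sigma> i \<le> b i}) \<inter> (\<Inter>n\<in>I. R n)"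
        using k by (auto simp: R_def)
      then show "(T \<times> {\<sigma>. \<forall>i. \<sigma> i \<le> b i}) \<inter> (\<Inter>n\<in>I. R n) \<noteq> {}"
        by (metis empty_iff)
    qed
    then obtain t \<sigma> where "t \<in> T" and *: "\<And>n. (t, \<sigma>) \<in> R n"
      by auto
    from * have "\<forall>n. w \<in> B n \<sigma> \<and> t \<in> K n \<sigma>"
      by (simp add: R_def)
    then show "w \<in> {w. \<exists>t\<in>T. \<exists>\<sigma>. \<forall>n. w \<in> B n \<sigma> \<and> t \<in> K n \<sigma>}"
      using \<open>t \<in> T\<close> by (intro CollectI bexI[of _ t] exI[of _ \<sigma>])
  qed
  ultimately show ?thesis by blast
qed

text \<open>A countable union of inner sets attains the outer measure of \<open>S\<close>, which is
  also the measure of a measurable hull. Since this is finite, \<open>S\<close> lies between two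
  measurable sets differing by a null set, and completeness applies.\<close>

lemma (in complete_measure) sets_if_inner_approx:
  assumes "finite_measure M" "S \<subseteq> space M"
    and inner: "\<And>c. c < outer_measure_of M S \<Longrightarrow> \<exists>E\<in>sets M. E \<subseteq> S \<and> c \<le> emeasure M E"
  shows "S \<in> sets M"
proof -
  interpret finite_measure M by fact
  obtain C where C: "C \<in> sets M" "S \<subseteq> C" "outer_measure_of M S = emeasure M C"
    using outer_measure_of_attain[OF assms(2)] by blast
  let ?I = "{E \<in> sets M. E \<subseteq> S}"
  have "emeasure M ` ?I \<noteq> {}" by auto
  then obtain f :: "nat \<Rightarrow> ennreal" where f: "range f \<subseteq> emeasure M ` ?I" "Sup (emeasure M ` ?I) = (SUP n. f n)"
    using ennreal_Sup_countable_SUP[of "emeasure M ` ?I"] by blast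
  then have "\<forall>n. \<exists>E\<in>?I. f n = emeasure M E" by blast
  then obtain E where E: "\<And>n. E n \<in> ?I" "\<And>n. f n = emeasure M (E n)" by metis
  have E_sets[simp]: "(\<Union>n. E n) \<in> sets M" using E(1) by auto
  have "emeasure M C \<le> Sup (emeasure M ` ?I)"
  proof (rule dense_le)
    fix c assume "c < emeasure M C"
    then obtain E' where "E' \<in> ?I" "c \<le> emeasure M E'" using inner C(3) by auto
    then show "c \<le> Sup (emeasure M ` ?I)" by (auto intro: SUP_upper2)
  qed
  also have "\<dots> \<le> emeasure M (\<Union>n. E n)"
    unfolding f(2) E(2) using E_sets by (intro SUP_least emeasure_mono) auto
  finally have "emeasure M C \<le> emeasure M (\<Union>n. E n)" .
  moreover have "(\<Union>n. E n) \<subseteq> S" using E(1) by auto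
  moreover from this have "emeasure M (\<Union>n. E n) \<le> emeasure M C"
    using C by (intro emeasure_mono) auto
  ultimately show ?thesis
    using C E_sets by (intro complete_sets_sandwich[of "\<Union>n. E n" C S]) (auto simp: less_top[symmetric])
qed

text \<open>Inner approximation needs compact time sets, so the time space is exhausted by closed
  balls and the projections are united.\<close>

theorem (in complete_measure) measurable_projection:
  fixes A :: "('a \<times> 't::euclidean_space) set"
  assumes "finite_measure M" and A: "A \<in> sets (M \<Otimes>\<^sub>M borel)"
  shows "fst ` A \<in> sets M"
proof -
  obtain B K where scheme: "souslin_scheme M B K"
    and A_eq: "A = souslin_kernel B K"
    using sets_pair_borel_imp_souslin_set[OF A] unfolding souslin_set_def by blast
  let ?S = "\<lambda>m::nat. {w. \<exists>t\<in>cball 0 (real m). \<exists>\<sigma>. \<forall>n. w \<in> B n \<sigma> \<and> t \<in> K n \<sigma>}"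
  have "?S m \<in> sets M" for m
  proof (rule sets_if_inner_approx)
    show "?S m \<subseteq> space M"
      using sets.sets_into_space[OF souslin_schemeD(1)[OF scheme]] by fastforce
  qed (use assms(1) souslin_projection_inner[OF assms(1) scheme compact_cball] in auto)
  moreover have "fst ` A = (\<Union>m. ?S m)"
  proof (intro equalityI subsetI)
    fix w assume "w \<in> fst ` A"
    then obtain t where "(w, t) \<in> A" by force
    moreover obtain m :: nat where "norm t \<le> real m" using real_arch_simple by blast
    ultimately show "w \<in> (\<Union>m. ?S m)" by (fastforce simp: A_eq souslin_kernel_def)
  qed (force simp: A_eq souslin_kernel_def)
  ultimately show ?thesis by auto
qed

section \<open>Right-continuous paths and independent times\<close>

text \<open>Discretising time leaves countably many measurable values, and right-continuity passes
  to the limit. \<open>max 0\<close> extends the process to the whole line, so that the plain Borel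
  sets of the reals can be used.\<close>

lemma borel_measurable_right_continuous_joint:
  fixes Y :: "real \<Rightarrow> 'a \<Rightarrow> 'b::metric_space"
  assumes Y: "\<And>t. 0 \<le> t \<Longrightarrow> Y t \<in> borel_measurable N"
    and rc: "\<And>w t. w \<in> space N \<Longrightarrow> 0 \<le> t \<Longrightarrow> continuous (at_right t) (\<lambda>s. Y s w)"
  shows "(\<lambda>z. Y (max 0 (snd z)) (fst z)) \<in> borel_measurable (N \<Otimes>\<^sub>M borel)"
proof -
  \<comment> \<open>\<open>Suc\<close> of the floor puts the grid point strictly to the right of
    \<open>t\<close>, as the punctured filter \<open>at_right t\<close> requires.\<close>
  define grid where "grid n t = real (Suc (nat \<lfloor>t * real (Suc n)\<rfloor>)) / real (Suc n)" for n :: nat and t :: real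
  have grid_measurable: "(\<lambda>z. Y (grid n (max 0 (snd z))) (fst z)) \<in> borel_measurable (N \<Otimes>\<^sub>M borel)" for n
  proof -
    have "(\<lambda>z. Y (real (Suc i) / real (Suc n)) (fst z)) \<in> borel_measurable (N \<Otimes>\<^sub>M (borel :: real measure))" for i
      by (intro measurable_compose[OF measurable_fst] Y) simp
    then show ?thesis
      unfolding grid_def
      by (rule measurable_compose_countable[where f = "\<lambda>i z. Y (real (Suc i) / real (Suc n)) (fst z)"]) measurable
  qed
  have grid_tendsto: "(\<lambda>n. Y (grid n (max 0 (snd z))) (fst z)) \<longlonglongrightarrow> Y (max 0 (snd z)) (fst z)"
    if "z \<in> space (N \<Otimes>\<^sub>M (borel :: real measure))" for z
  proof -
    from that have z: "fst z \<in> space N" by (auto simp: space_pair_measure)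
    define t where "t = max 0 (snd z)"
    have t: "0 \<le> t" by (simp add: t_def)
    have bounds: "t < grid n t \<and> grid n t \<le> t + inverse (real (Suc n))" for n
    proof -
      have "real (nat \<lfloor>t * real (Suc n)\<rfloor>) = of_int \<lfloor>t * real (Suc n)\<rfloor>"
        using t by (simp add: of_nat_nat)
      moreover have "t * real (Suc n) < of_int \<lfloor>t * real (Suc n)\<rfloor> + 1" "of_int \<lfloor>t * real (Suc n)\<rfloor> \<le> t * real (Suc n)"
        by linarith+
      ultimately have "t * real (Suc n) < real (nat \<lfloor>t * real (Suc n)\<rfloor>) + 1"
        "real (nat \<lfloor>t * real (Suc n)\<rfloor>) + 1 \<le> t * real (Suc n) + 1"
        by argo+
      then have "t * real (Suc n) < real (Suc (nat \<lfloor>t * real (Suc n)\<rfloor>))"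
        "real (Suc (nat \<lfloor>t * real (Suc n)\<rfloor>)) \<le> t * real (Suc n) + 1"
        by (simp_all only: of_nat_Suc[of "nat \<lfloor>t * real (Suc n)\<rfloor>"] add.commute)
      then show ?thesis
        unfolding grid_def by (auto simp: pos_less_divide_eq pos_divide_le_eq distrib_right simp del: of_nat_Suc)
    qed
    have "(\<lambda>n. grid n t) \<longlonglongrightarrow> t"
    proof (rule tendsto_sandwich[where f = "\<lambda>_. t" and h = "\<lambda>n. t + inverse (real (Suc n))"])
      show "(\<lambda>n. t + inverse (real (Suc n))) \<longlonglongrightarrow> t"
        using tendsto_add[OF tendsto_const LIMSEQ_inverse_real_of_nat, of t] by simp
      show "\<forall>\<^sub>F n in sequentially. t \<le> grid n t" "\<forall>\<^sub>F n in sequentially. grid n t \<le> t + inverse (real (Suc n))"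
        using bounds by (auto intro!: always_eventually less_imp_le)
    qed simp
    then have "filterlim (\<lambda>n. grid n t) (at_right t) sequentially"
      using bounds by (auto simp: filterlim_at less_imp_neq[THEN not_sym] intro!: always_eventually)
    moreover have "((\<lambda>s. Y s (fst z)) \<longlongrightarrow> Y t (fst z)) (at_right t)"
      using rc[OF z t] by (simp add: continuous_within)
    ultimately show ?thesis
      unfolding t_def by (rule filterlim_compose[rotated])
  qed
  from borel_measurable_LIMSEQ_metric[OF grid_measurable grid_tendsto] show ?thesis .
qed

lemma right_continuous_shift:
  fixes f :: "real \<Rightarrow> 'b::topological_space"
  assumes "continuous (at_right (c + t)) f"
  shows "continuous (at_right t) (\<lambda>s. f (c + s))"
proof -
  have "filterlim (\<lambda>s. c + s) (at_right (c + t)) (at_right t)"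
    using filtermap_at_right_shift[of "- c" t] by (simp add: filterlim_def add.commute)
  then show ?thesis
    using assms by (auto simp: continuous_within intro: filterlim_compose)
qed

lemma path_space_component: "0 \<le> t \<Longrightarrow> (\<lambda>w. w t) \<in> borel_measurable path_space"
  unfolding path_space_def by (intro measurable_restrict_space1 measurable_component_singleton) simp

lemma path_space_right_continuous:
  "w \<in> space path_space \<Longrightarrow> 0 \<le> t \<Longrightarrow> continuous (at_right t) w"
  unfolding path_space_def by (simp add: space_restrict_space)

text \<open>Reduces measurability of an upper limit to that of the suprema over half-lines.\<close>

lemma Limsup_at_top_real: "Limsup at_top (f :: real \<Rightarrow> 'a::complete_lattice) = (INF n::nat. SUP t\<in>{real n..}. f t)"
proof (rule antisym)
  show "Limsup at_top f \<le> (INF n::nat. SUP t\<in>{real n..}. f t)"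
    unfolding Limsup_def
  proof (rule INF_greatest)
    fix n :: nat
    show "(INF P\<in>{P. eventually P at_top}. SUP x\<in>{x. P x}. f x) \<le> (SUP t\<in>{real n..}. f t)"
      by (rule INF_lower2[of "\<lambda>t. real n \<le> t"]) (auto simp: atLeast_def eventually_ge_at_top)
  qed
  show "(INF n::nat. SUP t\<in>{real n..}. f t) \<le> Limsup at_top f"
    unfolding Limsup_def
  proof (rule INF_greatest)
    fix P :: "real \<Rightarrow> bool" assume "P \<in> {P. eventually P at_top}"
    then obtain N where N: "\<And>t. N \<le> t \<Longrightarrow> P t" by (auto simp: eventually_at_top_linorder)
    obtain n :: nat where "N \<le> real n" using real_arch_simple by blast
    then show "(INF n::nat. SUP t\<in>{real n..}. f t) \<le> (SUP x\<in>{x. P x}. f x)"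
      using N by (intro INF_lower2[of n] SUP_subset_mono) auto
  qed
qed

text \<open>Identifies the measure \<open>F(dt)\<close> inside \<open>Lam\<close> with the law of
  the delay, as both have the same distribution function.\<close>

lemma interval_measure_cdf_distr:
  assumes "prob_space M" "\<theta> \<in> borel_measurable M"
  shows "interval_measure (cdf (distr M borel \<theta>)) = distr M borel \<theta>"
proof (rule cdf_unique)
  interpret D: real_distribution "distr M borel \<theta>"
    using assms by (intro prob_space.real_distribution_distr) auto
  show "real_distribution (distr M borel \<theta>)" ..
  show "real_distribution (interval_measure (cdf (distr M borel \<theta>)))"
    by (intro real_distribution_interval_measure D.cdf_nondecreasing D.cdf_is_right_cont
          D.cdf_lim_at_bot D.cdf_lim_at_top_prob)
  show "cdf (interval_measure (cdf (distr M borel \<theta>))) = cdf (distr M borel \<theta>)"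
    by (intro cdf_interval_measure D.cdf_nondecreasing D.cdf_is_right_cont D.cdf_lim_at_bot)
qed

text \<open>The identity map is regarded as a random element of \<open>G\<close>; by independence
  its joint law with \<open>\<theta>\<close> is a product measure, checked on rectangles, and
  Tonelli does the rest.\<close>

lemma nn_integral_independent:
  fixes \<theta> :: "'w \<Rightarrow> real"
  assumes M: "prob_space M" and G: "subalgebra M G" and \<theta>[measurable]: "\<theta> \<in> borel_measurable M"
    and indep: "prob_space.indep_set M (sets G) (sets (vimage_algebra (space M) \<theta> borel))"
    and H[measurable]: "H \<in> borel_measurable (G \<Otimes>\<^sub>M borel)"
  shows "(\<integral>\<^sup>+ w. H (w, \<theta> w) \<partial>M) = (\<integral>\<^sup>+ w. \<integral>\<^sup>+ t. H (w, t) \<partial>distr M borel \<theta> \<partial>M)"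
proof -
  interpret prob_space M by fact
  let ?P = "restr_to_subalg M G" and ?\<mu> = "distr M borel \<theta>"
  interpret P: prob_space ?P by (rule prob_space_restr_to_subalg[OF G M])
  interpret D: prob_space ?\<mu> by (rule prob_space_distr) simp
  have [measurable_cong]: "sets ?P = sets G" by (rule sets_restr_to_subalg[OF G])
  have id[measurable]: "(\<lambda>w. w) \<in> M \<rightarrow>\<^sub>M G"
    using G by (auto simp: measurable_def subalgebra_def)
  have "?P \<Otimes>\<^sub>M ?\<mu> = distr M (G \<Otimes>\<^sub>M borel) (\<lambda>w. (w, \<theta> w))"
  proof (rule pair_measure_eqI)
    fix A B assume "A \<in> sets ?P" "B \<in> sets ?\<mu>"
    then have A[measurable]: "A \<in> sets G" and B[measurable]: "B \<in> sets borel"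
      by (simp_all add: sets_restr_to_subalg[OF G])
    have AM: "A \<in> sets M" using A G by (auto simp: subalgebra_def)
    have "\<theta> -` B \<inter> space M \<in> sets (vimage_algebra (space M) \<theta> borel)"
      by (rule in_vimage_algebra[OF B])
    then have "prob (A \<inter> (\<theta> -` B \<inter> space M)) = prob A * prob (\<theta> -` B \<inter> space M)"
      by (rule indep_setD[OF indep A])
    moreover have "(\<lambda>w. (w, \<theta> w)) -` (A \<times> B) \<inter> space M = A \<inter> (\<theta> -` B \<inter> space M)"
      using sets.sets_into_space[OF AM] by auto
    ultimately show "emeasure ?P A * emeasure ?\<mu> B = emeasure (distr M (G \<Otimes>\<^sub>M borel) (\<lambda>w. (w, \<theta> w))) (A \<times> B)"
      by (simp add: emeasure_restr_to_subalg[OF G A] emeasure_distr emeasure_eq_measure ennreal_mult' measure_nonneg)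
  next
    show "sets (?P \<Otimes>\<^sub>M ?\<mu>) = sets (distr M (G \<Otimes>\<^sub>M borel) (\<lambda>w. (w, \<theta> w)))"
      using sets_pair_measure_cong[OF sets_restr_to_subalg[OF G] refl, of borel] by simp
  qed (rule P.sigma_finite_measure_axioms D.sigma_finite_measure_axioms)+
  then have "(\<integral>\<^sup>+ w. H (w, \<theta> w) \<partial>M) = (\<integral>\<^sup>+ z. H z \<partial>(?P \<Otimes>\<^sub>M ?\<mu>))"
    by (simp add: nn_integral_distr)
  also have "\<dots> = (\<integral>\<^sup>+ w. \<integral>\<^sup>+ t. H (w, t) \<partial>?\<mu> \<partial>?P)"
    by (rule D.nn_integral_fst[symmetric]) measurable
  also have "\<dots> = (\<integral>\<^sup>+ w. \<integral>\<^sup>+ t. H (w, t) \<partial>?\<mu> \<partial>M)"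
    by (rule nn_integral_subalgebra2[OF G]) measurable
  finally show ?thesis .
qed

section \<open>Flows at stopping times\<close>

locale optional_stopping_flow = prob_space M
  for M :: "'w measure" +
  fixes Fil :: "ennreal \<Rightarrow> 'w measure"
    and X :: "'x::metric_space \<Rightarrow> real \<Rightarrow> 'w \<Rightarrow> 'x"
  assumes usual: "usual_conditions M Fil"
    and flow: "strong_markov_flow M Fil X"
begin

lemma filtration_Fil: "filtration (space M) Fil"
  and subalgebra_Fil: "subalgebra M (Fil t)"
  using usual unfolding usual_conditions_def by blast+

sublocale filtration "space M" Fil
  by (rule filtration_Fil)

lemma measurable_Fil_mono: "f \<in> Fil s \<rightarrow>\<^sub>M N \<Longrightarrow> s \<le> t \<Longrightarrow> f \<in> Fil t \<rightarrow>\<^sub>M N"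
  using sets_F_mono[of s t] by (auto simp: measurable_def space_F)

lemma measurable_Fil_imp_M: "f \<in> Fil t \<rightarrow>\<^sub>M N \<Longrightarrow> f \<in> M \<rightarrow>\<^sub>M N"
  by (rule measurable_from_subalg[OF subalgebra_Fil])

text \<open>Projection needs a complete measure, and completeness is assumed only for null sets of
  the base space; hence the restriction of \<open>M\<close>. Subsets of its null sets already lie in
  \<open>Fil 0\<close>.\<close>

lemma complete_Fil: "complete_measure (restr_to_subalg M (Fil top))"
proof
  fix A B assume "B \<subseteq> A" and A: "A \<in> null_sets (restr_to_subalg M (Fil top))"
  have "A \<in> sets (Fil top)" "emeasure M A = 0"
    using A by (auto simp: null_sets_restr_to_subalg[OF subalgebra_Fil])
  moreover have "\<forall>N\<in>sets (Fil top). emeasure M N = 0 \<longrightarrow> (\<forall>A\<subseteq>N. A \<in> sets (Fil 0))"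
    using usual unfolding usual_conditions_def infinity_ennreal_def by blast
  ultimately have "B \<in> sets (Fil 0)"
    using \<open>B \<subseteq> A\<close> by blast
  then show "B \<in> sets (restr_to_subalg M (Fil top))"
    using sets_F_mono[of 0 top] by (auto simp: sets_restr_to_subalg[OF subalgebra_Fil])
qed

lemma adapted: "0 \<le> t \<Longrightarrow> X x t \<in> borel_measurable (Fil (ennreal t))"
  and right_continuous: "w \<in> space M \<Longrightarrow> 0 \<le> t \<Longrightarrow> continuous (at_right t) (\<lambda>s. X x s w)"
  and strong_markov: "strong_markov M Fil X"
  using flow by (simp_all add: strong_markov_flow_def)

lemma X_measurable: "0 \<le> t \<Longrightarrow> X x t \<in> borel_measurable (Fil top)"
  by (rule measurable_Fil_mono[OF adapted top_greatest])

lemma X_joint_measurable: "(\<lambda>z. X x (max 0 (snd z)) (fst z)) \<in> borel_measurable (Fil top \<Otimes>\<^sub>M borel)"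
  by (rule borel_measurable_right_continuous_joint) (auto simp: X_measurable space_F right_continuous)

lemma X_random_time_measurable:
  assumes [measurable]: "T \<in> borel_measurable (Fil top)" and T: "\<And>w. 0 \<le> T w"
  shows "(\<lambda>w. X x (T w) w) \<in> borel_measurable (Fil top)"
proof -
  have "(\<lambda>w. (w, T w)) \<in> Fil top \<rightarrow>\<^sub>M Fil top \<Otimes>\<^sub>M borel" by measurable
  from measurable_compose[OF this X_joint_measurable] show ?thesis
    by (simp add: T max_def)
qed

lemma stopping_time_measurable:
  "stopping_time Fil \<tau> \<Longrightarrow> \<tau> \<in> borel_measurable (Fil top)"
  by (rule measurable_stopping_time[where F = Fil]) (auto simp: space_F intro: subsetD[OF sets_F_mono])

lemma pre_sigma_subset: "stopping_time Fil \<tau> \<Longrightarrow> A \<in> sets (pre_sigma \<tau>) \<Longrightarrow> A \<in> sets (Fil top)"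
  using sets_pre_sigmaD[of \<tau> A top] by simp

lemma subalgebra_pre_sigma: "stopping_time Fil \<tau> \<Longrightarrow> subalgebra M (pre_sigma \<tau>)"
  using pre_sigma_subset[of \<tau>] subalgebra_Fil[of top] by (auto simp: subalgebra_def space_pre_sigma)

text \<open>Right-continuity and adaptedness give progressive measurability.\<close>

lemma pred_X_stopping_time:
  assumes \<tau>: "stopping_time Fil \<tau>" and P[measurable]: "Measurable.pred borel P"
  shows "Measurable.pred (pre_sigma \<tau>) (\<lambda>w. \<tau> w < top \<and> P (X x (enn2real (\<tau> w)) w))"
proof (rule pred_pre_sigmaI[OF \<tau>])
  fix t :: ennreal
  show "Measurable.pred (Fil t) (\<lambda>w. (\<tau> w < top \<and> P (X x (enn2real (\<tau> w)) w)) \<and> \<tau> w \<le> t)"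
  proof (cases t)
    case top
    note [measurable] = stopping_time_measurable[OF \<tau>]
    have [measurable]: "(\<lambda>w. X x (enn2real (\<tau> w)) w) \<in> borel_measurable (Fil top)"
      by (rule X_random_time_measurable) auto
    have "Measurable.pred (Fil top) (\<lambda>w. \<tau> w < top \<and> P (X x (enn2real (\<tau> w)) w))"
      by measurable
    then show ?thesis using top by simp
  next
    case (real c)
    have [measurable]: "(\<lambda>w. min (\<tau> w) t) \<in> borel_measurable (Fil t)"
    proof (rule borel_measurableI_le)
      fix s
      show "{w \<in> space (Fil t). min (\<tau> w) t \<le> s} \<in> sets (Fil t)"
        using stopping_time_le_const[OF \<tau>, of s t]
        by (cases "t \<le> s") (auto simp: min_le_iff_disj pred_def)
    qed
    \<comment> \<open>The path is frozen at \<open>c\<close>, so that every value it takes is known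
      at time \<open>t\<close>. On the event that \<open>\<tau>\<close> is at most \<open>t\<close>
      the freezing has no effect.\<close>
    have "(\<lambda>z. X x (min c (max 0 (snd z))) (fst z)) \<in> borel_measurable (Fil t \<Otimes>\<^sub>M borel)"
    proof (rule borel_measurable_right_continuous_joint)
      fix s :: real assume s: "0 \<le> s"
      show "X x (min c s) \<in> borel_measurable (Fil t)"
        by (rule measurable_Fil_mono[OF adapted]) (use real s in \<open>auto intro: ennreal_leI\<close>)
      fix w assume "w \<in> space (Fil t)"
      then have w: "w \<in> space M" by (simp add: space_F)
      show "continuous (at_right s) (\<lambda>s. X x (min c s) w)"
      proof (cases "s < c")
        case True
        have "\<forall>\<^sub>F u in at_right s. u < c"
          using True by (simp add: eventually_at_right_less eventually_at_right_field) (use True in blast)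
        then have "\<forall>\<^sub>F u in at_right s. X x u w = X x (min c u) w"
          by eventually_elim simp
        moreover have "((\<lambda>u. X x u w) \<longlongrightarrow> X x s w) (at_right s)"
          using right_continuous[OF w s] by (simp add: continuous_within)
        ultimately show ?thesis
          using True by (auto simp: continuous_within intro: Lim_transform_eventually)
      next
        case False
        have "\<forall>\<^sub>F u in at_right s. X x c w = X x (min c u) w"
          using eventually_at_right_less[of s] by eventually_elim (use False in auto)
        then show ?thesis
          using False by (auto simp: continuous_within min_def intro: Lim_transform_eventually[OF tendsto_const])
      qed
    qed
    from measurable_compose[OF _ this, of "\<lambda>w. (w, enn2real (min (\<tau> w) t))" "Fil t"]
    have [measurable]: "(\<lambda>w. X x (min c (enn2real (min (\<tau> w) t))) w) \<in> borel_measurable (Fil t)"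
      by simp
    have "min c (enn2real (min (\<tau> w) t)) = enn2real (\<tau> w)" if "\<tau> w \<le> t" for w
      using that real enn2real_mono[of "\<tau> w" t] by (simp add: min_def)
    then have "((\<tau> w < top \<and> P (X x (enn2real (\<tau> w)) w)) \<and> \<tau> w \<le> t) \<longleftrightarrow>
        (P (X x (min c (enn2real (min (\<tau> w) t))) w) \<and> \<tau> w \<le> t)" for w
      using real by (auto simp: less_top[symmetric] top_unique)
    then show ?thesis
      using stopping_timeD[OF \<tau>, of t] by simp
  qed
qed

lemma path_from_measurable:
  assumes T: "T \<in> borel_measurable (Fil top)" and T0: "\<And>w. 0 \<le> T w"
  shows "(\<lambda>w. path_from (X x) (T w) w) \<in> Fil top \<rightarrow>\<^sub>M path_space"
  unfolding path_space_def
proof (rule measurable_restrict_space2)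
  show "(\<lambda>w. path_from (X x) (T w) w) \<in> space (Fil top) \<rightarrow> {w. \<forall>t\<ge>0. continuous (at_right t) w}"
  proof (intro Pi_I CollectI allI impI)
    fix w and t :: real assume "w \<in> space (Fil top)" and t: "0 \<le> t"
    then have "continuous (at_right (T w + t)) (\<lambda>s. X x s w)"
      using T0[of w] by (intro right_continuous) (auto simp: space_F)
    then have "((\<lambda>s. X x (T w + s) w) \<longlongrightarrow> X x (T w + t) w) (at_right t)"
      using right_continuous_shift by (fastforce simp: continuous_within)
    moreover have "\<forall>\<^sub>F s in at_right t. X x (T w + s) w = path_from (X x) (T w) w s"
      using eventually_at_right_less[of t] by eventually_elim (use t in \<open>auto simp: path_from_def\<close>)
    ultimately show "continuous (at_right t) (path_from (X x) (T w) w)"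
      using t by (auto simp: continuous_within path_from_def intro: Lim_transform_eventually)
  qed
  show "(\<lambda>w. path_from (X x) (T w) w) \<in> Fil top \<rightarrow>\<^sub>M (\<Pi>\<^sub>M t\<in>{0..}. borel)"
    unfolding path_from_def
  proof (rule measurable_restrict)
    fix t :: real assume "t \<in> {0..}"
    then show "(\<lambda>w. X x (T w + t) w) \<in> borel_measurable (Fil top)"
      using T T0 by (intro X_random_time_measurable) auto
  qed
qed

text \<open>A Borel function of the flow need not be right-continuous in time, so the limit superior runs over
  uncountably many times; the level sets are measurable by projection.\<close>

lemma Limsup_X_measurable:
  fixes h :: "'x \<Rightarrow> ennreal"
  assumes [measurable]: "h \<in> borel_measurable borel"
  shows "(\<lambda>w. Limsup at_top (\<lambda>t. h (X x t w))) \<in> borel_measurable (Fil top)"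
proof -
  interpret P: complete_measure "restr_to_subalg M (Fil top)" by (rule complete_Fil)
  have fin: "finite_measure (restr_to_subalg M (Fil top))"
    by (rule finite_measure_restr_to_subalg[OF subalgebra_Fil]) unfold_locales
  have sets_P: "sets (restr_to_subalg M (Fil top)) = sets (Fil top)"
    by (rule sets_restr_to_subalg[OF subalgebra_Fil])
  note [measurable] = X_joint_measurable
  have "(\<lambda>w. SUP t\<in>{real n..}. h (X x t w)) \<in> borel_measurable (Fil top)" for n
  proof (rule borel_measurableI_greater)
    fix a
    let ?A = "{z \<in> space (Fil top \<Otimes>\<^sub>M borel). real n \<le> snd z \<and> a < h (X x (max 0 (snd z)) (fst z))}"
    have "?A \<in> sets (Fil top \<Otimes>\<^sub>M borel)" by measurable
    also have "sets (Fil top \<Otimes>\<^sub>M borel) = sets (restr_to_subalg M (Fil top) \<Otimes>\<^sub>M (borel :: real measure))"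
      by (rule sets_pair_measure_cong) (simp_all only: sets_P)
    finally have "fst ` ?A \<in> sets (Fil top)"
      using P.measurable_projection[OF fin] sets_P by blast
    also have "fst ` ?A = {w \<in> space (Fil top). a < (SUP t\<in>{real n..}. h (X x t w))}"
    proof (intro equalityI subsetI)
      fix w assume "w \<in> {w \<in> space (Fil top). a < (SUP t\<in>{real n..}. h (X x t w))}"
      then obtain t where "w \<in> space (Fil top)" "real n \<le> t" "a < h (X x t w)"
        by (auto simp: less_SUP_iff)
      moreover from this have "max 0 t = t" by simp
      ultimately have "(w, t) \<in> ?A" by (simp add: space_pair_measure)
      then show "w \<in> fst ` ?A" by force
    next
      fix w assume "w \<in> fst ` ?A"
      then obtain t where "w \<in> space (Fil top)" "real n \<le> t" "a < h (X x (max 0 t) w)"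
        by (auto simp: space_pair_measure)
      moreover from this have "max 0 t = t" by simp
      ultimately show "w \<in> {w \<in> space (Fil top). a < (SUP t\<in>{real n..}. h (X x t w))}"
        by (auto simp: less_SUP_iff)
    qed
    finally show "{w \<in> space (Fil top). a < (SUP t\<in>{real n..}. h (X x t w))} \<in> sets (Fil top)" .
  qed
  then show ?thesis
    unfolding Limsup_at_top_real by measurable
qed

lemma eval_at_less_pre_sigma:
  fixes f g :: "'x \<Rightarrow> ennreal"
  assumes \<tau>: "stopping_time Fil \<tau>"
    and [measurable]: "f \<in> borel_measurable borel" "g \<in> borel_measurable borel"
  shows "Measurable.pred (pre_sigma \<tau>) (\<lambda>w. eval_at (X x) f \<tau> w < eval_at (X x) g \<tau> w)"
proof -
  have [measurable]: "Measurable.pred (pre_sigma \<tau>) (\<lambda>w. \<tau> w < top \<and> f (X x (enn2real (\<tau> w)) w) < g (X x (enn2real (\<tau> w)) w))"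
    by (rule pred_X_stopping_time[OF \<tau>]) measurable
  let ?L = "\<lambda>f w. Limsup at_top (\<lambda>t. f (X x t w))"
  have [measurable]: "Measurable.pred (pre_sigma \<tau>) (\<lambda>w. \<tau> w = top \<and> ?L f w < ?L g w)"
  proof (rule pred_pre_sigmaI[OF \<tau>])
    fix t :: ennreal
    note [measurable] = stopping_time_measurable[OF \<tau>] Limsup_X_measurable
    show "Measurable.pred (Fil t) (\<lambda>w. (\<tau> w = top \<and> ?L f w < ?L g w) \<and> \<tau> w \<le> t)"
    proof (cases "t = top")
      case True
      have "Measurable.pred (Fil top) (\<lambda>w. \<tau> w = top \<and> ?L f w < ?L g w)"
        by measurable
      then show ?thesis using True by simp
    next
      case False
      \<comment> \<open>On the event of an infinite stopping time, the sigma-algebra at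
        \<open>\<tau>\<close> imposes no condition at finite times, so measurability in
        \<open>Fil top\<close> is enough.\<close>
      then have "(\<lambda>w. (\<tau> w = top \<and> ?L f w < ?L g w) \<and> \<tau> w \<le> t) = (\<lambda>_. False)"
        by (auto simp: top_unique)
      then show ?thesis by simp
    qed
  qed
  have "eval_at (X x) f \<tau> w < eval_at (X x) g \<tau> w \<longleftrightarrow>
      (\<tau> w < top \<and> f (X x (enn2real (\<tau> w)) w) < g (X x (enn2real (\<tau> w)) w)) \<or> (\<tau> w = top \<and> ?L f w < ?L g w)" for w
    by (auto simp: eval_at_def less_top)
  then show ?thesis by simp
qed

end

section \<open>Delayed rewards\<close>

text \<open>The discounted reward of a single path with the delay averaged under
  \<open>\<mu>\<close>; its expectation from a starting point is \<open>Lam\<close> when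
  \<open>\<mu>\<close> is the law of the delay. \<open>max 0 t\<close> keeps the argument in the
  index set of paths, and the indicator removes the negative times.\<close>

definition discounted_path :: "real \<Rightarrow> ('x \<Rightarrow> ennreal) \<Rightarrow> real measure \<Rightarrow> (real \<Rightarrow> 'x) \<Rightarrow> ennreal" where
  "discounted_path r g \<mu> w = (\<integral>\<^sup>+ t. indicator {0..} t * ennreal (exp (- r * t)) * g (w (max 0 t)) \<partial>\<mu>)"

lemma discounted_path_measurable:
  fixes g :: "'x::metric_space \<Rightarrow> ennreal"
  assumes \<mu>: "sigma_finite_measure \<mu>" "sets \<mu> = sets borel" and [measurable]: "g \<in> borel_measurable borel"
  shows "discounted_path r g \<mu> \<in> borel_measurable path_space"
proof -
  interpret sigma_finite_measure \<mu> by fact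
  note [measurable_cong] = \<mu>(2)
  have [measurable]: "(\<lambda>z. fst z (max 0 (snd z))) \<in> borel_measurable ((path_space :: (real \<Rightarrow> 'x) measure) \<Otimes>\<^sub>M borel)"
    by (rule borel_measurable_right_continuous_joint[where Y = "\<lambda>t w. w t"])
      (auto simp: path_space_component path_space_right_continuous)
  have "(\<lambda>z. indicator {0..} (snd z) * ennreal (exp (- r * snd z)) * g (fst z (max 0 (snd z))))
      \<in> borel_measurable (path_space \<Otimes>\<^sub>M \<mu>)"
    by measurable
  then show ?thesis
    unfolding discounted_path_def[abs_def] by (intro borel_measurable_nn_integral) (simp add: case_prod_beta')
qed

lemma discount_measurable[measurable]: "discount r \<in> borel_measurable borel"
  unfolding discount_def[abs_def] by measurable

lemma discount_add: "s \<noteq> top \<Longrightarrow> 0 \<le> t \<Longrightarrow> discount r (s + ennreal t) = discount r s * ennreal (exp (- r * t))"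
  by (simp add: discount_def enn2real_plus less_top[symmetric] ennreal_mult'[symmetric] mult_exp_exp distrib_left)

context optional_stopping_flow
begin

lemma X_joint_measurable_M: "(\<lambda>z. X x (max 0 (snd z)) (fst z)) \<in> borel_measurable (M \<Otimes>\<^sub>M borel)"
  by (rule borel_measurable_right_continuous_joint)
    (auto intro: measurable_Fil_imp_M[OF X_measurable] right_continuous)

lemma Ex_discounted_path:
  assumes \<mu>: "sigma_finite_measure \<mu>" "sets \<mu> = sets borel" and [measurable]: "g \<in> borel_measurable borel"
  shows "Ex M X y (discounted_path r g \<mu>) =
    (\<integral>\<^sup>+ t\<in>{0..}. ennreal (exp (- r * t)) * (\<integral>\<^sup>+ w. g (X y t w) \<partial>M) \<partial>\<mu>)"
proof -
  interpret sigma_finite_measure \<mu> by fact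
  interpret P: pair_sigma_finite M \<mu> ..
  note [measurable_cong] = \<mu>(2)
  note [measurable] = X_joint_measurable_M
  have "Ex M X y (discounted_path r g \<mu>) =
      (\<integral>\<^sup>+ w. \<integral>\<^sup>+ t. indicator {0..} t * ennreal (exp (- r * t)) * g (X y (max 0 t) w) \<partial>\<mu> \<partial>M)"
    by (simp add: Ex_def discounted_path_def path_from_def)
  also have "\<dots> = (\<integral>\<^sup>+ t. \<integral>\<^sup>+ w. indicator {0..} t * ennreal (exp (- r * t)) * g (X y (max 0 t) w) \<partial>M \<partial>\<mu>)"
    using P.Fubini[of "\<lambda>z. indicator {0..} (snd z) * ennreal (exp (- r * snd z)) * g (X y (max 0 (snd z)) (fst z))"]
    by simp
  also have "\<dots> = (\<integral>\<^sup>+ t\<in>{0..}. ennreal (exp (- r * t)) * (\<integral>\<^sup>+ w. g (X y t w) \<partial>M) \<partial>\<mu>)"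
  proof (rule nn_integral_cong)
    fix t
    have "(\<lambda>w. g (X y t w)) \<in> borel_measurable M" if "0 \<le> t"
      using measurable_Fil_imp_M[OF X_measurable[OF that]] by measurable
    then show "(\<integral>\<^sup>+ w. indicator {0..} t * ennreal (exp (- r * t)) * g (X y (max 0 t) w) \<partial>M) =
        ennreal (exp (- r * t)) * (\<integral>\<^sup>+ w. g (X y t w) \<partial>M) * indicator {0..} t"
      by (auto split: split_indicator simp: nn_integral_cmult)
  qed
  finally show ?thesis .
qed

text \<open>Independence integrates the delay out for a fixed path; the strong Markov property, applied to the
  resulting path functional as a whole, restarts the flow at the stopping time.\<close>

lemma nn_integral_delayed:
  fixes g :: "'x \<Rightarrow> ennreal"
  assumes \<tau>: "stopping_time Fil \<tau>" and A: "A \<in> sets (pre_sigma \<tau>)" and g[measurable]: "g \<in> borel_measurable borel"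
    and indep: "independent_time M Fil \<theta>"
  shows "(\<integral>\<^sup>+ w. indicator A w * (discount r (\<tau> w + ennreal (\<theta> w)) * g (X x (enn2real (\<tau> w) + \<theta> w) w)) \<partial>M) =
    (\<integral>\<^sup>+ w. indicator A w * (discount r (\<tau> w) *
        Ex M X (X x (enn2real (\<tau> w)) w) (discounted_path r g (distr M borel \<theta>))) \<partial>M)"
proof -
  have \<theta>[measurable]: "\<theta> \<in> borel_measurable M" and \<theta>0: "\<And>w. w \<in> space M \<Longrightarrow> 0 \<le> \<theta> w"
    and ind: "indep_set (sets (Fil top)) (sets (vimage_algebra (space M) \<theta> borel))"
    using indep by (simp_all add: independent_time_def)
  let ?\<mu> = "distr M borel \<theta>" and ?G = "discounted_path r g (distr M borel \<theta>)"
  let ?T = "\<lambda>w. enn2real (\<tau> w)"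
  interpret D: prob_space ?\<mu> by (rule prob_space_distr) simp
  have G: "?G \<in> borel_measurable path_space"
    by (rule discounted_path_measurable) (auto intro: D.sigma_finite_measure_axioms)
  \<comment> \<open>Everything known at \<open>\<tau>\<close> is collected in one factor. It
    vanishes where \<open>\<tau>\<close> is infinite, so the default \<open>enn2real top = 0\<close>
    does no harm and the indicator in \<open>strong_markov\<close> can be inserted or
    dropped.\<close>
  define c where "c w = indicator A w * discount r (\<tau> w)" for w
  have c_pre: "c \<in> borel_measurable (pre_sigma \<tau>)"
    unfolding c_def using A measurable_compose[OF measurable_stopping_time_pre_sigma[OF \<tau>] discount_measurable]
    by measurable
  have c[measurable]: "c \<in> borel_measurable (Fil top)"
    by (rule measurable_from_subalg[OF _ c_pre])
      (use pre_sigma_subset[OF \<tau>] in \<open>simp add: subalgebra_def space_F space_pre_sigma subset_eq\<close>)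
  have c_top: "c w = 0" if "\<tau> w = top" for w
    using that by (simp add: c_def discount_def)
  note [measurable] = stopping_time_measurable[OF \<tau>]
  \<comment> \<open>The delay becomes a free second variable, and the first enters through
    \<open>Fil top\<close> only, as independence requires.\<close>
  define H where "H z = c (fst z) * (indicator {0..} (snd z) * ennreal (exp (- r * snd z)) *
      g (X x (?T (fst z) + max 0 (snd z)) (fst z)))" for z
  have "(\<lambda>z. X x (max 0 (snd z)) (fst z)) \<circ> (\<lambda>z. (fst z, ?T (fst z) + max 0 (snd z)))
      \<in> borel_measurable (Fil top \<Otimes>\<^sub>M borel)"
    by (rule measurable_comp[OF _ X_joint_measurable]) measurable
  then have [measurable]: "(\<lambda>z. X x (?T (fst z) + max 0 (snd z)) (fst z)) \<in> borel_measurable (Fil top \<Otimes>\<^sub>M borel)"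
    by (simp add: comp_def max_absorb2)
  have H: "H \<in> borel_measurable (Fil top \<Otimes>\<^sub>M borel)"
    unfolding H_def[abs_def] by measurable
  have path[measurable]: "(\<lambda>w. path_from (X x) (?T w) w) \<in> M \<rightarrow>\<^sub>M path_space"
    by (rule measurable_Fil_imp_M[OF path_from_measurable]) auto
  have "(\<integral>\<^sup>+ w. indicator A w * (discount r (\<tau> w + ennreal (\<theta> w)) * g (X x (?T w + \<theta> w) w)) \<partial>M) =
      (\<integral>\<^sup>+ w. H (w, \<theta> w) \<partial>M)"
  proof (rule nn_integral_cong)
    fix w assume "w \<in> space M"
    then have "0 \<le> \<theta> w" by (rule \<theta>0)
    then show "indicator A w * (discount r (\<tau> w + ennreal (\<theta> w)) * g (X x (?T w + \<theta> w) w)) = H (w, \<theta> w)"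
      by (cases "\<tau> w = top") (auto simp: H_def c_def discount_add discount_def[of r top] ac_simps)
  qed
  also have "\<dots> = (\<integral>\<^sup>+ w. \<integral>\<^sup>+ t. H (w, t) \<partial>?\<mu> \<partial>M)"
    by (rule nn_integral_independent[OF prob_space_axioms subalgebra_Fil \<theta> ind H])
  also have "\<dots> = (\<integral>\<^sup>+ w. c w * (?G (path_from (X x) (?T w) w) * indicator {w. \<tau> w < \<infinity>} w) \<partial>M)"
  proof (rule nn_integral_cong)
    fix w assume w: "w \<in> space M"
    have "(\<lambda>t. X x (?T w + max 0 t) w) \<in> borel_measurable borel"
      using measurable_Pair2[OF \<open>(\<lambda>z. X x (?T (fst z) + max 0 (snd z)) (fst z)) \<in> _\<close>, of w] w
      by (simp add: space_F)
    then have "(\<integral>\<^sup>+ t. H (w, t) \<partial>?\<mu>) = c w * ?G (path_from (X x) (?T w) w)"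
      unfolding H_def by (simp add: nn_integral_cmult discounted_path_def path_from_def)
    then show "(\<integral>\<^sup>+ t. H (w, t) \<partial>?\<mu>) = c w * (?G (path_from (X x) (?T w) w) * indicator {w. \<tau> w < \<infinity>} w)"
      by (cases "\<tau> w = top") (simp_all add: c_top less_top)
  qed
  \<comment> \<open>Conditioning does not change the integral, since the factor \<open>c\<close> is
    measurable at \<open>\<tau>\<close>.\<close>
  also have "\<dots> = (\<integral>\<^sup>+ w. c w * nn_cond_exp M (pre_sigma \<tau>)
      (\<lambda>w. ?G (path_from (X x) (?T w) w) * indicator {w. \<tau> w < \<infinity>} w) w \<partial>M)"
  proof (rule sigma_finite_subalgebra.nn_cond_exp_intg[OF _ c_pre, symmetric])
    show "sigma_finite_subalgebra M (pre_sigma \<tau>)"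
      by (intro finite_measure_subalgebra_is_sigma_finite finite_measure_subalgebra.intro
          finite_measure_subalgebra_axioms.intro subalgebra_pre_sigma \<tau>) unfold_locales
    have [measurable]: "\<tau> \<in> borel_measurable M"
      by (rule measurable_Fil_imp_M) measurable
    show "(\<lambda>w. ?G (path_from (X x) (?T w) w) * indicator {w. \<tau> w < \<infinity>} w) \<in> borel_measurable M"
      using G by measurable
  qed
  also have "\<dots> = (\<integral>\<^sup>+ w. c w * (Ex M X (X x (?T w) w) ?G * indicator {w. \<tau> w < \<infinity>} w) \<partial>M)"
  proof (rule nn_integral_cong_AE)
    have "AE w in M. nn_cond_exp M (pre_sigma \<tau>)
        (\<lambda>w. ?G (path_from (X x) (?T w) w) * indicator {w. \<tau> w < \<infinity>} w) w =
        Ex M X (X x (?T w) w) ?G * indicator {w. \<tau> w < \<infinity>} w"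
      using strong_markov G \<tau> unfolding strong_markov_def by blast
    then show "AE w in M. c w * nn_cond_exp M (pre_sigma \<tau>)
        (\<lambda>w. ?G (path_from (X x) (?T w) w) * indicator {w. \<tau> w < \<infinity>} w) w =
        c w * (Ex M X (X x (?T w) w) ?G * indicator {w. \<tau> w < \<infinity>} w)"
      by eventually_elim (simp only:)
  qed
  also have "\<dots> = (\<integral>\<^sup>+ w. indicator A w * (discount r (\<tau> w) * Ex M X (X x (?T w) w) ?G) \<partial>M)"
  proof (rule nn_integral_cong)
    fix w
    show "c w * (Ex M X (X x (?T w) w) ?G * indicator {w. \<tau> w < \<infinity>} w) =
        indicator A w * (discount r (\<tau> w) * Ex M X (X x (?T w) w) ?G)"
      by (cases "\<tau> w = top") (auto simp: c_def discount_def[of r top] less_top ac_simps)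
  qed
  finally show ?thesis .
qed

end

section \<open>Comparison of the two problems\<close>

locale delayed_stopping = optional_stopping_flow M Fil X
  for M :: "'w measure" and Fil and X :: "'x::metric_space \<Rightarrow> real \<Rightarrow> 'w \<Rightarrow> 'x" +
  fixes \<theta> :: "'w \<Rightarrow> real" and F :: "real \<Rightarrow> real" and r p :: real and \<phi> \<psi> v :: "'x \<Rightarrow> real"
  assumes indep: "independent_time M Fil \<theta>"
    and F: "F = cdf (distr M borel \<theta>)"
    and p: "0 \<le> p" "p \<le> 1"
    and \<phi>_borel[measurable]: "\<phi> \<in> borel_measurable borel"
    and \<psi>_borel[measurable]: "\<psi> \<in> borel_measurable borel"
    and v_borel[measurable]: "v \<in> borel_measurable borel"
    and \<psi>_nonneg: "\<And>y. 0 \<le> \<psi> y" and v_nonneg: "\<And>y. 0 \<le> v y"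
begin

abbreviation reward :: "'x \<Rightarrow> ennreal" where
  "reward y \<equiv> ennreal (p * \<psi> y + (1 - p) * v y)"

abbreviation \<Lambda>v :: "'x \<Rightarrow> ennreal" where
  "\<Lambda>v \<equiv> Lam M X F r p \<psi> v"

abbreviation \<phi>' :: "'x \<Rightarrow> ennreal" where
  "\<phi>' \<equiv> \<lambda>y. ennreal (\<phi> y)"

lemma Lam_eq_Ex: "\<Lambda>v = (\<lambda>y. Ex M X y (discounted_path r reward (distr M borel \<theta>)))"
proof
  fix y
  have \<theta>: "\<theta> \<in> borel_measurable M" using indep by (simp add: independent_time_def)
  then interpret D: prob_space "distr M borel \<theta>" by (rule prob_space_distr)
  show "\<Lambda>v y = Ex M X y (discounted_path r reward (distr M borel \<theta>))"
    unfolding Lam_def F interval_measure_cdf_distr[OF prob_space_axioms \<theta>]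
    by (rule Ex_discounted_path[symmetric]) (auto intro: D.sigma_finite_measure_axioms)
qed

text \<open>The first clause of \<open>strong_markov\<close> makes the expectation of a measurable
  path functional Borel in the starting point; no continuity of \<open>\<Lambda>v\<close> is
  derived.\<close>

lemma Lam_borel[measurable]: "\<Lambda>v \<in> borel_measurable borel"
proof -
  have \<theta>: "\<theta> \<in> borel_measurable M" using indep by (simp add: independent_time_def)
  then interpret D: prob_space "distr M borel \<theta>" by (rule prob_space_distr)
  have "discounted_path r reward (distr M borel \<theta>) \<in> borel_measurable path_space"
    by (rule discounted_path_measurable) (auto intro: D.sigma_finite_measure_axioms)
  then show ?thesis
    using strong_markov unfolding Lam_eq_Ex strong_markov_def by blast
qed

text \<open>On the event that the stopping time is infinite all discounted terms vanish, whatever the value of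
  the limit superior.\<close>

lemma payoff1_eq:
  assumes adm: "(\<tau>, \<alpha>) \<in> admissible M Fil"
  shows "payoff1 M X \<theta> r p \<phi> \<psi> v x (\<tau>, \<alpha>) =
    (\<integral>\<^sup>+ w. discount r (\<tau> w) *
       (if \<alpha> w = 0 then eval_at (X x) \<phi>' \<tau> w else eval_at (X x) \<Lambda>v \<tau> w) \<partial>M)"
proof -
  have \<tau>: "stopping_time Fil \<tau>" and \<alpha>: "\<alpha> \<in> pre_sigma \<tau> \<rightarrow>\<^sub>M count_space {0, 1}"
    using adm by (simp_all add: admissible_def)
  have \<theta>0: "\<And>w. w \<in> space M \<Longrightarrow> 0 \<le> \<theta> w" and [measurable]: "\<theta> \<in> borel_measurable M"
    using indep by (simp_all add: independent_time_def)
  let ?T = "\<lambda>w. enn2real (\<tau> w)"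
  have \<alpha>01: "\<alpha> w = 0 \<or> \<alpha> w = 1" if "w \<in> space M" for w
    using measurable_space[OF \<alpha>, of w] that by (simp add: space_pre_sigma)
  define A where "A = {w \<in> space M. \<alpha> w = 1}"
  define B where "B = {w \<in> space M. \<alpha> w = 0}"
  have A: "A \<in> sets (pre_sigma \<tau>)" and B: "B \<in> sets (pre_sigma \<tau>)"
    using measurable_sets[OF \<alpha>, of "{1}"] measurable_sets[OF \<alpha>, of "{0}"]
    by (simp_all add: A_def B_def space_pre_sigma vimage_def Int_def conj_commute)
  have [measurable]: "A \<in> sets M" "B \<in> sets M"
    using A B subalgebra_pre_sigma[OF \<tau>] by (auto simp: subalgebra_def)
  have \<tau>_M[measurable]: "\<tau> \<in> borel_measurable M"
    by (rule measurable_Fil_imp_M[OF stopping_time_measurable[OF \<tau>]])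
  have [measurable]: "(\<lambda>w. X x (?T w) w) \<in> borel_measurable M"
    using stopping_time_measurable[OF \<tau>] by (intro measurable_Fil_imp_M[OF X_random_time_measurable]) auto
  have [measurable]: "(\<lambda>w. X x (?T w + \<theta> w) w) \<in> borel_measurable M"
  proof -
    have "(\<lambda>w. (w, ?T w + \<theta> w)) \<in> M \<rightarrow>\<^sub>M M \<Otimes>\<^sub>M borel" by measurable
    from measurable_compose[OF this X_joint_measurable_M[of x]]
    show ?thesis by (rule measurable_cong[THEN iffD1, rotated]) (simp add: \<theta>0)
  qed
  \<comment> \<open>At an infinite time the right side evaluates the path at time 0 by default, but
    both sides carry the factor zero, even against an infinite upper limit.\<close>
  have eval: "discount r (\<tau> w) * eval_at (X x) f \<tau> w = discount r (\<tau> w) * f (X x (?T w) w)" for w f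
    by (simp add: eval_at_def discount_def)
  have "payoff1 M X \<theta> r p \<phi> \<psi> v x (\<tau>, \<alpha>) =
      (\<integral>\<^sup>+ w. indicator B w * (discount r (\<tau> w) * \<phi>' (X x (?T w) w)) +
         indicator A w * (discount r (\<tau> w + ennreal (\<theta> w)) * reward (X x (?T w + \<theta> w) w)) \<partial>M)"
    unfolding payoff1_def Let_def prod.case
  proof (rule nn_integral_cong)
    fix w assume w: "w \<in> space M"
    let ?\<rho> = "\<lambda>w. \<tau> w + ennreal (\<theta> w)"
    have "discount r (?\<rho> w) * (ennreal p * eval_at (X x) (\<lambda>y. ennreal (\<psi> y)) ?\<rho> w
        + ennreal (1 - p) * eval_at (X x) (\<lambda>y. ennreal (v y)) ?\<rho> w) =
        discount r (?\<rho> w) * reward (X x (?T w + \<theta> w) w)"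
    proof (cases "\<tau> w = top")
      case False
      then have "?\<rho> w \<noteq> top" "enn2real (?\<rho> w) = ?T w + \<theta> w"
        using \<theta>0[OF w] by (simp_all add: enn2real_plus less_top[symmetric])
      then show ?thesis
        using p \<psi>_nonneg v_nonneg by (simp add: eval_at_def ennreal_mult ennreal_plus)
    qed (simp add: discount_def)
    then show "discount r (\<tau> w) * eval_at (X x) \<phi>' \<tau> w * indicator {w. \<alpha> w = 0} w +
        discount r (?\<rho> w) * (ennreal p * eval_at (X x) (\<lambda>y. ennreal (\<psi> y)) ?\<rho> w
        + ennreal (1 - p) * eval_at (X x) (\<lambda>y. ennreal (v y)) ?\<rho> w) * indicator {w. \<alpha> w = 1} w =
        indicator B w * (discount r (\<tau> w) * \<phi>' (X x (?T w) w)) +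
        indicator A w * (discount r (?\<rho> w) * reward (X x (?T w + \<theta> w) w))"
      using w by (simp add: eval A_def B_def indicator_def)
  qed
  also have "\<dots> = (\<integral>\<^sup>+ w. indicator B w * (discount r (\<tau> w) * \<phi>' (X x (?T w) w)) \<partial>M) +
      (\<integral>\<^sup>+ w. indicator A w * (discount r (\<tau> w + ennreal (\<theta> w)) * reward (X x (?T w + \<theta> w) w)) \<partial>M)"
    by (rule nn_integral_add) measurable
  also have "(\<integral>\<^sup>+ w. indicator A w * (discount r (\<tau> w + ennreal (\<theta> w)) * reward (X x (?T w + \<theta> w) w)) \<partial>M) =
      (\<integral>\<^sup>+ w. indicator A w * (discount r (\<tau> w) * \<Lambda>v (X x (?T w) w)) \<partial>M)"
    unfolding Lam_eq_Ex by (rule nn_integral_delayed[OF \<tau> A _ indep]) measurable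
  also have "(\<integral>\<^sup>+ w. indicator B w * (discount r (\<tau> w) * \<phi>' (X x (?T w) w)) \<partial>M) + \<dots> =
      (\<integral>\<^sup>+ w. indicator B w * (discount r (\<tau> w) * \<phi>' (X x (?T w) w)) +
        indicator A w * (discount r (\<tau> w) * \<Lambda>v (X x (?T w) w)) \<partial>M)"
    by (rule nn_integral_add[symmetric]) measurable
  also have "\<dots> = (\<integral>\<^sup>+ w. discount r (\<tau> w) *
      (if \<alpha> w = 0 then eval_at (X x) \<phi>' \<tau> w else eval_at (X x) \<Lambda>v \<tau> w) \<partial>M)"
  proof (rule nn_integral_cong)
    fix w assume "w \<in> space M"
    with \<alpha>01[of w] show "indicator B w * (discount r (\<tau> w) * \<phi>' (X x (?T w) w)) +
        indicator A w * (discount r (\<tau> w) * \<Lambda>v (X x (?T w) w)) =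
        discount r (\<tau> w) * (if \<alpha> w = 0 then eval_at (X x) \<phi>' \<tau> w else eval_at (X x) \<Lambda>v \<tau> w)"
      by (auto simp: A_def B_def eval)
  qed
  finally show ?thesis .
qed

lemma payoff1_le_payoff2:
  "(\<tau>, \<alpha>) \<in> admissible M Fil \<Longrightarrow> payoff1 M X \<theta> r p \<phi> \<psi> v x (\<tau>, \<alpha>) \<le> payoff2 M X F r p \<phi> \<psi> v x \<tau>"
  unfolding payoff1_eq payoff2_def by (intro nn_integral_mono mult_left_mono) auto

lemma alpha_star_admissible:
  assumes \<tau>: "stopping_time Fil \<tau>"
  shows "(\<tau>, alpha_star M X F r p \<phi> \<psi> v x \<tau>) \<in> admissible M Fil"
proof -
  have [measurable]: "Measurable.pred (pre_sigma \<tau>) (\<lambda>w. eval_at (X x) \<phi>' \<tau> w < eval_at (X x) \<Lambda>v \<tau> w)"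
    by (rule eval_at_less_pre_sigma[OF \<tau>]) measurable
  have "alpha_star M X F r p \<phi> \<psi> v x \<tau> \<in> pre_sigma \<tau> \<rightarrow>\<^sub>M count_space {0, 1}"
    unfolding alpha_star_def[abs_def] by (rule measurable_If) auto
  then show ?thesis
    using \<tau> by (simp add: admissible_def)
qed

text \<open>\<open>alpha_star\<close> selects the larger of the two rewards pointwise; in a tie it
  takes the immediate one, which leaves the value unchanged.\<close>

lemma payoff1_alpha_star:
  assumes "stopping_time Fil \<tau>"
  shows "payoff1 M X \<theta> r p \<phi> \<psi> v x (\<tau>, alpha_star M X F r p \<phi> \<psi> v x \<tau>) = payoff2 M X F r p \<phi> \<psi> v x \<tau>"
  unfolding payoff1_eq[OF alpha_star_admissible[OF assms]] payoff2_def
  by (intro nn_integral_cong) (auto simp: alpha_star_def max_def)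

lemma SUP_payoff_eq:
  "(SUP \<tau>\<alpha>\<in>admissible M Fil. payoff1 M X \<theta> r p \<phi> \<psi> v x \<tau>\<alpha>) =
   (SUP \<tau>\<in>{\<tau>. stopping_time Fil \<tau>}. payoff2 M X F r p \<phi> \<psi> v x \<tau>)"
proof (rule antisym)
  show "(SUP \<tau>\<alpha>\<in>admissible M Fil. payoff1 M X \<theta> r p \<phi> \<psi> v x \<tau>\<alpha>) \<le>
      (SUP \<tau>\<in>{\<tau>. stopping_time Fil \<tau>}. payoff2 M X F r p \<phi> \<psi> v x \<tau>)"
  proof (rule SUP_least)
    fix \<tau>\<alpha> assume adm: "\<tau>\<alpha> \<in> admissible M Fil"
    then have "fst \<tau>\<alpha> \<in> {\<tau>. stopping_time Fil \<tau>}" by (auto simp: admissible_def)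
    then show "payoff1 M X \<theta> r p \<phi> \<psi> v x \<tau>\<alpha> \<le> (SUP \<tau>\<in>{\<tau>. stopping_time Fil \<tau>}. payoff2 M X F r p \<phi> \<psi> v x \<tau>)"
      using payoff1_le_payoff2[of "fst \<tau>\<alpha>" "snd \<tau>\<alpha>" x] adm by (intro SUP_upper2) simp_all
  qed
  show "(SUP \<tau>\<in>{\<tau>. stopping_time Fil \<tau>}. payoff2 M X F r p \<phi> \<psi> v x \<tau>) \<le>
      (SUP \<tau>\<alpha>\<in>admissible M Fil. payoff1 M X \<theta> r p \<phi> \<psi> v x \<tau>\<alpha>)"
    by (intro SUP_least SUP_upper2[OF alpha_star_admissible[where x = x]]) (auto simp: payoff1_alpha_star)
qed

end

theorem lemma2p5:
  fixes M :: "'w measure"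
    and Fil :: "ennreal \<Rightarrow> 'w measure"
    and X :: "real ^ 'd \<Rightarrow> real \<Rightarrow> 'w \<Rightarrow> real ^ 'd"
    and \<theta> :: "'w \<Rightarrow> real"
    and F :: "real \<Rightarrow> real"
    and r p :: real
    and \<phi> \<psi> v :: "real ^ 'd \<Rightarrow> real"
  assumes "prob_space M"
    and "usual_conditions M Fil"
    and "strong_markov_flow M Fil X"
    and "independent_time M Fil \<theta>"
    and "F = cdf (distr M borel \<theta>)"
    and "r > 0" and "0 < p" and "p < 1"
    and "continuous_on UNIV \<phi>" and "continuous_on UNIV \<psi>"
    and "\<And>x. 0 \<le> \<phi> x" and "\<And>x. \<phi> x \<le> \<psi> x"
    and "continuous_on UNIV v" and "\<And>x. 0 \<le> v x"
  shows "(solves_problem1 M Fil X \<theta> r p \<phi> \<psi> v \<longleftrightarrow> solves_problem2 M Fil X F r p \<phi> \<psi> v) \<and>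
    (solves_problem2 M Fil X F r p \<phi> \<psi> v \<longrightarrow>
      (\<forall>x \<tau>. optimal_problem2 M Fil X F r p \<phi> \<psi> v x \<tau> \<longrightarrow>
        optimal_problem1 M Fil X \<theta> r p \<phi> \<psi> v x (\<tau>, alpha_star M X F r p \<phi> \<psi> v x \<tau>)))"
proof -
  interpret prob_space M by fact
  interpret delayed_stopping M Fil X \<theta> F r p \<phi> \<psi> v
  proof
    show "0 \<le> \<psi> y" for y using assms(11,12)[of y] by linarith
  qed (use assms in \<open>auto intro: borel_measurable_continuous_onI\<close>)
  show ?thesis
    \<comment> \<open>With equal suprema for this very \<open>v\<close>, the two fixed-point
      equations coincide. An optimal \<open>\<tau>\<close> attains the common supremum, and pairing
      it with \<open>alpha_star\<close> preserves the payoff.\<close>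
    unfolding solves_problem1_def solves_problem2_def optimal_problem1_def optimal_problem2_def SUP_payoff_eq
    using alpha_star_admissible payoff1_alpha_star by auto
qed

end
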